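(* The variety $\mathfrak{Leib}_4$ of four-dimensional complex Leibniz algebras does not have the Grunewald--O'Halloran Property; that is, it is not true that for every nilpotent algebra $A\in\mathfrak{Leib}_4$ there is a non-nilpotent algebra $B\in\mathfrak{Leib}_4$ such that $B\to A$.
   Context: All vector spaces and algebras are over $\mathbb{C}$. An algebra is a vector space with a bilinear multiplication; it is a Leibniz algebra if $(xy)z=(xz)y+x(yz)$ for all $x,y,z$. Let $V$ be a vector space of dimension $n$ with fixed basis $e_1,\dots,e_n$. The space $\mathrm{Hom}(V\otimes V,V)$ is identified with the affine space $\mathbb{C}^{n^3}$ via structure constants $c_{i,j}^k$, where $\mu(e_i\otimes e_j)=\sum_k c_{i,j}^k e_k$, and carries the Zariski topology. $\mathfrak{Leib}_n\subset \mathrm{Hom}(V\otimes V,V)$ is the Zariski closed subset of structures satisfying the Leibniz identity. The group $GL(V)$ acts on $\mathfrak{Leib}_n$ by $(g*\mu)(x\otimes y)=g\mu(g^{-1}x\otimes g^{-1}y)$, and $O(\mu)$ denotes the orbit of $\mu$, $\overline{O(\mu)}$ its Zariski closure. If $n$-dimensional Leibniz algebras $A$ and $B$ are represented by $\mu,\lambda\in\mathfrak{Leib}_n$ respectively, then $A$ degenerates to $B$, written $A\to B$, if $\lambda\in\overline{O(\mu)}$ (this does not depend on the choice of $\mu$ and $\lambda$). A variety $\mathfrak{A}$ of algebras has the Grunewald--O'Halloran Property if for any nilpotent algebra $A\in\mathfrak{A}$ there is a non-nilpotent algebra $B\in\mathfrak{A}$ such that $B\to A$. *)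

theory Defs
  imports "HOL-Analysis.Analysis"
begin

text \<open>
  The underlying space is \<open>V = complex ^ 'n\<close> with basis \<open>axis i 1\<close>; an algebra structure on it is a
  multiplication in \<open>Hom(V \<otimes> V, V)\<close>, given in curried form.
\<close>

type_synonym 'n alg = "complex ^ 'n \<Rightarrow> complex ^ 'n \<Rightarrow> complex ^ 'n"

definition alg_structures :: "('n::finite) alg set" where
  "alg_structures =
     {\<mu>. (\<forall>x. Vector_Spaces.linear (*s) (*s) (\<lambda>y. \<mu> x y)) \<and>
         (\<forall>y. Vector_Spaces.linear (*s) (*s) (\<lambda>x. \<mu> x y))}"

definition structure_constant :: "('n::finite) alg \<Rightarrow> 'n \<Rightarrow> 'n \<Rightarrow> 'n \<Rightarrow> complex" where
  "structure_constant \<mu> i j k = \<mu> (axis i 1) (axis j 1) $ k"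

definition leibniz_structures :: "('n::finite) alg set" where
  "leibniz_structures =
     {\<mu> \<in> alg_structures. \<forall>x y z. \<mu> (\<mu> x y) z = \<mu> (\<mu> x z) y + \<mu> x (\<mu> y z)}"

inductive polynomial_in_constants :: "(('n::finite) alg \<Rightarrow> complex) \<Rightarrow> bool" where
  const: "polynomial_in_constants (\<lambda>\<mu>. a)"
| coord: "polynomial_in_constants (\<lambda>\<mu>. structure_constant \<mu> i j k)"
| add: "polynomial_in_constants p \<Longrightarrow> polynomial_in_constants q \<Longrightarrow>
          polynomial_in_constants (\<lambda>\<mu>. p \<mu> + q \<mu>)"
| mult: "polynomial_in_constants p \<Longrightarrow> polynomial_in_constants q \<Longrightarrow>
          polynomial_in_constants (\<lambda>\<mu>. p \<mu> * q \<mu>)"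

definition zero_locus :: "(('n::finite) alg \<Rightarrow> complex) set \<Rightarrow> 'n alg set" where
  "zero_locus P = {\<mu> \<in> alg_structures. \<forall>p\<in>P. p \<mu> = 0}"

definition zariski_open :: "('n::finite) alg set \<Rightarrow> bool" where
  "zariski_open U \<longleftrightarrow>
     (\<exists>P \<subseteq> Collect polynomial_in_constants. U = alg_structures - zero_locus P)"

definition zariski_topology :: "('n::finite) alg topology" where
  "zariski_topology = topology zariski_open"

lemma mem_diff_zero_locus:
  "\<mu> \<in> alg_structures - zero_locus P \<longleftrightarrow> \<mu> \<in> alg_structures \<and> (\<exists>p\<in>P. p \<mu> \<noteq> 0)"
  unfolding zero_locus_def by blast

lemma istopology_zariski_open: "istopology (zariski_open :: ('n::finite) alg set \<Rightarrow> bool)"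
  unfolding istopology_def
proof (intro conjI allI impI)
  fix S T :: "'n alg set"
  assume "zariski_open S" "zariski_open T"
  then obtain P Q where P: "P \<subseteq> Collect polynomial_in_constants" "S = alg_structures - zero_locus P"
    and Q: "Q \<subseteq> Collect polynomial_in_constants" "T = alg_structures - zero_locus Q"
    unfolding zariski_open_def by blast
  let ?R = "{\<lambda>\<mu>. p \<mu> * q \<mu> | p q. p \<in> P \<and> q \<in> Q}"
  have "?R \<subseteq> Collect polynomial_in_constants"
    using P(1) Q(1) by (auto intro: polynomial_in_constants.mult)
  moreover have "S \<inter> T = alg_structures - zero_locus ?R"
  proof (rule set_eqI)
    fix \<mu>
    have "(\<exists>r\<in>?R. r \<mu> \<noteq> 0) \<longleftrightarrow> (\<exists>p\<in>P. p \<mu> \<noteq> 0) \<and> (\<exists>q\<in>Q. q \<mu> \<noteq> 0)"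
    proof
      assume "(\<exists>p\<in>P. p \<mu> \<noteq> 0) \<and> (\<exists>q\<in>Q. q \<mu> \<noteq> 0)"
      then obtain p q where "p \<in> P" "q \<in> Q" "p \<mu> * q \<mu> \<noteq> 0"
        by auto
      then show "\<exists>r\<in>?R. r \<mu> \<noteq> 0"
        by (intro bexI[of _ "\<lambda>\<mu>. p \<mu> * q \<mu>"]) auto
    qed auto
    then show "\<mu> \<in> S \<inter> T \<longleftrightarrow> \<mu> \<in> alg_structures - zero_locus ?R"
      unfolding P(2) Q(2) Int_iff mem_diff_zero_locus by argo
  qed
  ultimately show "zariski_open (S \<inter> T)"
    unfolding zariski_open_def by blast
next
  fix K :: "'n alg set set"
  assume "\<forall>S\<in>K. zariski_open S"
  then have "\<forall>S\<in>K. \<exists>P. P \<subseteq> Collect polynomial_in_constants \<and> S = alg_structures - zero_locus P"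
    unfolding zariski_open_def by simp
  from bchoice[OF this] obtain F where
      F: "\<forall>S\<in>K. F S \<subseteq> Collect polynomial_in_constants \<and> S = alg_structures - zero_locus (F S)"
    by blast
  have eq: "alg_structures - zero_locus (F S) = S" if "S \<in> K" for S
    using bspec[OF F that] by (elim conjE) (rule sym)
  have "\<Union>K = (\<Union>S\<in>K. alg_structures - zero_locus (F S))"
    by (simp add: eq)
  also have "\<dots> = alg_structures - zero_locus (\<Union>S\<in>K. F S)"
    unfolding zero_locus_def by blast
  finally have "\<Union>K = alg_structures - zero_locus (\<Union>S\<in>K. F S)" .
  moreover have "(\<Union>S\<in>K. F S) \<subseteq> Collect polynomial_in_constants"
    by (intro UN_least) (erule bspec[OF F, THEN conjunct1])
  ultimately show "zariski_open (\<Union>K)"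
    unfolding zariski_open_def by (intro exI conjI)
qed

lemma openin_zariski_topology: "openin zariski_topology = zariski_open"
  unfolding zariski_topology_def by (rule topology_inverse'[OF istopology_zariski_open])

lemma topspace_zariski_topology: "topspace zariski_topology = (alg_structures :: ('n::finite) alg set)"
proof -
  have "zariski_open (alg_structures :: 'n alg set)"
    unfolding zariski_open_def
    by (rule exI[of _ "{\<lambda>\<mu>. 1}"]) (auto simp: zero_locus_def intro: polynomial_in_constants.const)
  moreover have "U \<subseteq> alg_structures" if "zariski_open U" for U :: "'n alg set"
    using that unfolding zariski_open_def by blast
  ultimately show ?thesis
    unfolding topspace_def openin_zariski_topology by blast
qed

definition general_linear :: "(complex ^ 'n \<Rightarrow> complex ^ ('n::finite)) set" where
  "general_linear = {g. Vector_Spaces.linear (*s) (*s) g \<and> bij g}"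

definition alg_action :: "(complex ^ 'n \<Rightarrow> complex ^ 'n) \<Rightarrow> ('n::finite) alg \<Rightarrow> 'n alg" where
  "alg_action g \<mu> = (\<lambda>x y. g (\<mu> (inv g x) (inv g y)))"

definition orbit :: "('n::finite) alg \<Rightarrow> 'n alg set" where
  "orbit \<mu> = {alg_action g \<mu> | g. g \<in> general_linear}"

definition degenerates_to :: "('n::finite) alg \<Rightarrow> 'n alg \<Rightarrow> bool" where
  "degenerates_to \<mu> \<nu> \<longleftrightarrow> \<nu> \<in> zariski_topology closure_of (orbit \<mu>)"

text \<open>
  Powers of a not necessarily associative algebra: \<open>A\<^sup>1 = A\<close> and \<open>A\<^sup>k\<close> is spanned by all products
  from \<open>A\<^sup>i A\<^sup>k\<^sup>-\<^sup>i\<close> with \<open>1 \<le> i < k\<close>. The value at \<open>k = 0\<close> is irrelevant.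
\<close>

fun alg_power :: "('n::finite) alg \<Rightarrow> nat \<Rightarrow> (complex ^ 'n) set" where
  "alg_power \<mu> k =
     (if k \<le> 1 then UNIV
      else vec.span (\<Union>i\<in>{1..<k}. {\<mu> x y | x y. x \<in> alg_power \<mu> i \<and> y \<in> alg_power \<mu> (k - i)}))"

declare alg_power.simps [simp del]

definition nilpotent_alg :: "('n::finite) alg \<Rightarrow> bool" where
  "nilpotent_alg \<mu> \<longleftrightarrow> (\<exists>k\<ge>1. alg_power \<mu> k = {0})"

definition grunewald_ohalloran_property :: "('n::finite) alg set \<Rightarrow> bool" where
  "grunewald_ohalloran_property \<AA> \<longleftrightarrow>
     (\<forall>A\<in>\<AA>. nilpotent_alg A \<longrightarrow>
        (\<exists>B\<in>\<AA>. \<not> nilpotent_alg B \<and> degenerates_to B A))"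

end

theory Submission
  imports Defs
begin

text \<open>
  Let \<open>A\<close> have the products \<open>e1e1 = e2e2 = e3e1 = e4\<close>, \<open>e1e3 = -e4\<close>, \<open>e2e1 = e3\<close>, \<open>e1e2 = -e3\<close>. It lies in
  the closure of a one-parameter family of non-nilpotent orbits, but not in the closure of a
  single one. Indeed, if \<open>B \<rightarrow> A\<close>, then the right annihilator of \<open>B\<close> is at most a line, hence the
  squares of \<open>B\<close> span a line \<open>\<complex> i\<close> with \<open>B i = 0\<close> and \<open>i x = \<chi>(x) i\<close>, and the quadratic form
  \<open>xx = Q(x) i\<close> has rank at least 2 on a complement. Solving the Leibniz identity under these
  constraints shows that a non-nilpotent \<open>B\<close> satisfies one of two kinds of identities with
  constants depending only on \<open>B\<close>: either \<open>(yx)x\<close> is a combination of \<open>yx, xy, y, x, xx\<close> whose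
  coefficients are constants times \<open>\<chi>(x), \<chi>(x), \<chi>(x)\<^sup>2, \<chi>(x)\<chi>(y), \<chi>(y)\<close>, or
  \<open>(yx)x = \<tau>(x)(yx - xy)/2 + \<chi>(x)(xy + yx) - \<chi>(y)xx + N i\<close> with
  \<open>N\<^sup>2 = \<kappa> \<tau>(x)\<^sup>2 (Q(x)Q(y) - Q(x,y)\<^sup>2)\<close>, where \<open>Q(x,y)\<close> is the polarisation of \<open>Q\<close> and \<open>\<tau>\<close> is an
  eigenvalue of right multiplication.
  Both persist in the orbit closure, where \<open>A\<close> has \<open>\<chi> = \<tau> = 0\<close> but \<open>(e2e1)e1 = e4\<close>.
\<close>

section \<open>Regular functions on the space of structures\<close>

text \<open>Agreement with a polynomial is asked only on \<open>alg_structures\<close>, because off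
  the bilinear maps a product is not determined by its structure constants.\<close>

definition regular_fun :: "(('n::finite) alg \<Rightarrow> complex) \<Rightarrow> bool" where
  "regular_fun F \<longleftrightarrow>
     (\<exists>p. polynomial_in_constants p \<and> (\<forall>\<mu>\<in>alg_structures. F \<mu> = p \<mu>))"

definition regular_vec :: "(('n::finite) alg \<Rightarrow> complex ^ 'n) \<Rightarrow> bool" where
  "regular_vec V \<longleftrightarrow> (\<forall>k. regular_fun (\<lambda>\<mu>. V \<mu> $ k))"

lemma regular_fun_const: "regular_fun (\<lambda>\<mu>. a)"
  unfolding regular_fun_def by (blast intro: polynomial_in_constants.const)

lemma regular_fun_add:
  assumes "regular_fun F" "regular_fun G"
  shows "regular_fun (\<lambda>\<mu>. F \<mu> + G \<mu>)"
proof -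
  obtain p q where "polynomial_in_constants p" "\<forall>\<mu>\<in>alg_structures. F \<mu> = p \<mu>"
    "polynomial_in_constants q" "\<forall>\<mu>\<in>alg_structures. G \<mu> = q \<mu>"
    using assms unfolding regular_fun_def by blast
  then show ?thesis
    unfolding regular_fun_def
    by (intro exI[of _ "\<lambda>\<mu>. p \<mu> + q \<mu>"]) (simp add: polynomial_in_constants.add)
qed

lemma regular_fun_mult:
  assumes "regular_fun F" "regular_fun G"
  shows "regular_fun (\<lambda>\<mu>. F \<mu> * G \<mu>)"
proof -
  obtain p q where "polynomial_in_constants p" "\<forall>\<mu>\<in>alg_structures. F \<mu> = p \<mu>"
    "polynomial_in_constants q" "\<forall>\<mu>\<in>alg_structures. G \<mu> = q \<mu>"
    using assms unfolding regular_fun_def by blast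
  then show ?thesis
    unfolding regular_fun_def
    by (intro exI[of _ "\<lambda>\<mu>. p \<mu> * q \<mu>"]) (simp add: polynomial_in_constants.mult)
qed

lemma regular_fun_diff:
  assumes "regular_fun F" "regular_fun G"
  shows "regular_fun (\<lambda>\<mu>. F \<mu> - G \<mu>)"
  using regular_fun_add[OF assms(1) regular_fun_mult[OF regular_fun_const[of "-1"] assms(2)]]
  by simp

lemma regular_fun_power: "regular_fun F \<Longrightarrow> regular_fun (\<lambda>\<mu>. F \<mu> ^ k)"
  by (induction k) (simp_all add: regular_fun_const regular_fun_mult)

lemma regular_fun_sum:
  assumes "finite I" "\<And>i. i \<in> I \<Longrightarrow> regular_fun (F i)"
  shows "regular_fun (\<lambda>\<mu>. \<Sum>i\<in>I. F i \<mu>)"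
  using assms
  by (induction I rule: finite_induct) (simp_all add: regular_fun_const regular_fun_add)

lemma regular_fun_nth: "regular_vec V \<Longrightarrow> regular_fun (\<lambda>\<mu>. V \<mu> $ k)"
  by (simp add: regular_vec_def)

lemma regular_vec_const: "regular_vec (\<lambda>\<mu>. v)"
  by (simp add: regular_vec_def regular_fun_const)

lemma alg_structures_simps:
  assumes "\<mu> \<in> alg_structures"
  shows "\<mu> (x + y) z = \<mu> x z + \<mu> y z" "\<mu> z (x + y) = \<mu> z x + \<mu> z y"
    "\<mu> (c *s x) z = c *s \<mu> x z" "\<mu> z (c *s x) = c *s \<mu> z x"
    "\<mu> 0 z = 0" "\<mu> z 0 = 0"
    "\<mu> (x - y) z = \<mu> x z - \<mu> y z" "\<mu> z (x - y) = \<mu> z x - \<mu> z y"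
    "\<mu> (- x) z = - \<mu> x z" "\<mu> z (- x) = - \<mu> z x"
proof -
  have l: "Vector_Spaces.linear (*s) (*s) (\<lambda>y. \<mu> x y)"
    and r: "Vector_Spaces.linear (*s) (*s) (\<lambda>x. \<mu> x y)" for x y
    using assms unfolding alg_structures_def by blast+
  show "\<mu> (x + y) z = \<mu> x z + \<mu> y z" "\<mu> z (x + y) = \<mu> z x + \<mu> z y"
    "\<mu> (c *s x) z = c *s \<mu> x z" "\<mu> z (c *s x) = c *s \<mu> z x"
    "\<mu> 0 z = 0" "\<mu> z 0 = 0"
    "\<mu> (x - y) z = \<mu> x z - \<mu> y z" "\<mu> z (x - y) = \<mu> z x - \<mu> z y"
    "\<mu> (- x) z = - \<mu> x z" "\<mu> z (- x) = - \<mu> z x"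
    by (rule vec.linear_add[OF r] vec.linear_add[OF l] vec.linear_scale[OF r] vec.linear_scale[OF l]
        vec.linear_0[OF r] vec.linear_0[OF l] vec.linear_diff[OF r] vec.linear_diff[OF l]
        vec.linear_neg[OF r] vec.linear_neg[OF l])+
qed

lemma alg_structures_expand:
  assumes "\<mu> \<in> alg_structures"
  shows "\<mu> x y $ k = (\<Sum>j\<in>UNIV. \<Sum>i\<in>UNIV. y $ j * (x $ i * structure_constant \<mu> i j k))"
proof -
  have l: "Vector_Spaces.linear (*s) (*s) (\<lambda>y. \<mu> x y)"
    and r: "Vector_Spaces.linear (*s) (*s) (\<lambda>x. \<mu> x y)" for x y
    using assms unfolding alg_structures_def by blast+
  have "\<mu> x y = \<mu> (\<Sum>i\<in>UNIV. x $ i *s axis i 1) (\<Sum>j\<in>UNIV. y $ j *s axis j 1)"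
    by (simp only: basis_expansion)
  also have "\<dots> = (\<Sum>j\<in>UNIV. y $ j *s (\<Sum>i\<in>UNIV. x $ i *s \<mu> (axis i 1) (axis j 1)))"
    by (simp add: vec.linear_sum[OF r] vec.linear_sum[OF l] alg_structures_simps[OF assms])
  finally show ?thesis
    by (simp add: structure_constant_def sum_distrib_left)
qed

text \<open>Iterated products of fixed vectors thus have regular coordinates, so the regularity of
  each test function below follows from its shape alone.\<close>

lemma regular_vec_product:
  assumes "regular_vec V" "regular_vec W"
  shows "regular_vec (\<lambda>\<mu>. \<mu> (V \<mu>) (W \<mu>))"
  unfolding regular_vec_def
proof
  fix k :: 'a
  have c: "regular_fun (\<lambda>\<mu>. structure_constant \<mu> i j k)" for i j :: 'a
    unfolding regular_fun_def by (blast intro: polynomial_in_constants.coord)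
  have "regular_fun (\<lambda>\<mu>. \<Sum>j\<in>UNIV. \<Sum>i\<in>UNIV. W \<mu> $ j * (V \<mu> $ i * structure_constant \<mu> i j k))"
    by (intro regular_fun_sum regular_fun_mult regular_fun_nth assms c finite)
  then show "regular_fun (\<lambda>\<mu>. \<mu> (V \<mu>) (W \<mu>) $ k)"
    unfolding regular_fun_def by (simp add: alg_structures_expand)
qed

lemmas regular_intros =
  regular_fun_const regular_fun_add regular_fun_mult regular_fun_diff regular_fun_power
  regular_fun_nth regular_vec_const regular_vec_product

text \<open>The nonvanishing locus of \<open>F\<close> is open, so if it contained \<nu> it would
  meet the orbit. Every later use of the Zariski topology goes through this fact.\<close>

lemma regular_fun_vanishes_at_degeneration:
  assumes "degenerates_to \<mu> \<nu>" "regular_fun F" "\<And>\<mu>'. \<mu>' \<in> orbit \<mu> \<Longrightarrow> F \<mu>' = 0"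
  shows "F \<nu> = 0"
proof (rule ccontr)
  assume nz: "F \<nu> \<noteq> 0"
  obtain p where p: "polynomial_in_constants p" "\<forall>\<mu>\<in>alg_structures. F \<mu> = p \<mu>"
    using assms(2) unfolding regular_fun_def by blast
  let ?U = "alg_structures - zero_locus {p}"
  have cl: "\<nu> \<in> zariski_topology closure_of (orbit \<mu>)"
    using assms(1) unfolding degenerates_to_def .
  then have \<nu>: "\<nu> \<in> alg_structures"
    by (simp add: in_closure_of topspace_zariski_topology)
  have "openin zariski_topology ?U"
    unfolding openin_zariski_topology zariski_open_def using p(1) by blast
  moreover have "\<nu> \<in> ?U"
    using nz p(2) \<nu> unfolding mem_diff_zero_locus by simp
  ultimately obtain \<mu>' where "\<mu>' \<in> orbit \<mu>" "\<mu>' \<in> ?U"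
    using cl unfolding in_closure_of by blast
  then show False
    using p(2) assms(3) unfolding mem_diff_zero_locus by auto
qed

section \<open>The special nilpotent algebra\<close>

text \<open>\<open>U\<close> contains all powers from the second on, \<open>I\<close> all from the
  third on. In every splitting of 5 into two parts one part is at least 3, so each product spanning
  the fifth power has a factor in \<open>I\<close>.\<close>

lemma nilpotent_alg_if_class_le_4:
  assumes \<mu>: "\<mu> \<in> alg_structures"
    and U: "vec.subspace U" "\<And>x y. \<mu> x y \<in> U"
    and I: "vec.subspace I" "\<And>x u. u \<in> U \<Longrightarrow> \<mu> x u \<in> I \<and> \<mu> u x \<in> I"
    and 0: "\<And>x u. u \<in> I \<Longrightarrow> \<mu> x u = 0 \<and> \<mu> u x = 0"
  shows "nilpotent_alg \<mu>"
proof -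
  have p2: "alg_power \<mu> k \<subseteq> U" if "k \<ge> 2" for k
  proof -
    have "alg_power \<mu> k = vec.span (\<Union>i\<in>{1..<k}. {\<mu> x y | x y. x \<in> alg_power \<mu> i \<and> y \<in> alg_power \<mu> (k - i)})"
      using that by (subst alg_power.simps) simp
    also have "\<dots> \<subseteq> U"
      by (rule vec.span_minimal[OF _ U(1)]) (use U(2) in blast)
    finally show ?thesis .
  qed
  have p3: "alg_power \<mu> k \<subseteq> I" if k: "k \<ge> 3" for k
  proof -
    have "\<mu> x y \<in> I" if i: "i \<in> {1..<k}" and x: "x \<in> alg_power \<mu> i" and y: "y \<in> alg_power \<mu> (k - i)" for i x y
    proof (cases "i \<ge> 2")
      case True
      then show ?thesis using p2[of i] x I(2) by blast
    next
      case False
      then have "k - i \<ge> 2" using k i by auto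
      then have "y \<in> U" using p2 y by blast
      then show ?thesis using I(2) by blast
    qed
    then have "(\<Union>i\<in>{1..<k}. {\<mu> x y | x y. x \<in> alg_power \<mu> i \<and> y \<in> alg_power \<mu> (k - i)}) \<subseteq> I"
      by blast
    then have "vec.span (\<Union>i\<in>{1..<k}. {\<mu> x y | x y. x \<in> alg_power \<mu> i \<and> y \<in> alg_power \<mu> (k - i)}) \<subseteq> I"
      by (rule vec.span_minimal[OF _ I(1)])
    then show ?thesis
      using k by (subst alg_power.simps) simp
  qed
  have "\<mu> x y = 0" if i: "i \<in> {1..<5}" and x: "x \<in> alg_power \<mu> i" and y: "y \<in> alg_power \<mu> (5 - i)" for i x y
  proof (cases "i \<ge> 3")
    case True
    then show ?thesis using p3[of i] x 0 by blast
  next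
    case False
    then have "5 - i \<ge> 3" by auto
    then have "y \<in> I" using p3 y by blast
    then show ?thesis using 0 by blast
  qed
  then have "(\<Union>i\<in>{1..<5}. {\<mu> x y | x y. x \<in> alg_power \<mu> i \<and> y \<in> alg_power \<mu> (5 - i)}) \<subseteq> {0}"
    by blast
  then have "vec.span (\<Union>i\<in>{1..<5}. {\<mu> x y | x y. x \<in> alg_power \<mu> i \<and> y \<in> alg_power \<mu> (5 - i)}) \<subseteq> {0}"
    by (rule vec.span_minimal) (rule vec.subspace_single_0)
  then have "alg_power \<mu> 5 \<subseteq> {0}"
    by (subst alg_power.simps) simp
  moreover have "0 \<in> alg_power \<mu> 5"
    by (subst alg_power.simps) (simp add: vec.span_zero)
  ultimately show ?thesis
    unfolding nilpotent_alg_def by (intro exI[of _ 5]) auto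
qed

text \<open>Modulo the central line of \<open>axis 4 1\<close> this is the Heisenberg Lie algebra,
  hence the name.\<close>

definition heisenberg_ext :: "4 alg" where
  "heisenberg_ext x y = (x $ 2 * y $ 1 - x $ 1 * y $ 2) *s axis 3 1 +
     (x $ 1 * y $ 1 + x $ 2 * y $ 2 + x $ 3 * y $ 1 - x $ 1 * y $ 3) *s axis 4 1"

lemma heisenberg_ext_nth [simp]:
  "heisenberg_ext x y $ 1 = 0" "heisenberg_ext x y $ 2 = 0"
  "heisenberg_ext x y $ 3 = x $ 2 * y $ 1 - x $ 1 * y $ 2"
  "heisenberg_ext x y $ 4 = x $ 1 * y $ 1 + x $ 2 * y $ 2 + x $ 3 * y $ 1 - x $ 1 * y $ 3"
  by (simp_all add: heisenberg_ext_def axis_def)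

text \<open>Such a form stands for the coordinate \<open>\<lambda>v. g v $ 4\<close> after a change
  of basis \<open>g\<close>, which keeps \<open>g\<close> out of the identities proved in the
  locales.\<close>

definition linear_form :: "(complex ^ ('n::finite) \<Rightarrow> complex) \<Rightarrow> bool" where
  "linear_form \<phi> \<longleftrightarrow> (\<forall>x y. \<phi> (x + y) = \<phi> x + \<phi> y) \<and> (\<forall>c x. \<phi> (c *s x) = c * \<phi> x)"

lemma heisenberg_ext_alg: "heisenberg_ext \<in> alg_structures"
  unfolding alg_structures_def
  by (simp add: Vector_Spaces.linear_iff vec.vector_space_axioms vec_eq_iff forall_4 algebra_simps)

lemma heisenberg_ext_leibniz: "heisenberg_ext \<in> leibniz_structures"
proof -
  have "heisenberg_ext (heisenberg_ext x y) z = heisenberg_ext (heisenberg_ext x z) y + heisenberg_ext x (heisenberg_ext y z)" for x y z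
    by (simp add: vec_eq_iff forall_4 algebra_simps)
  then show ?thesis
    unfolding leibniz_structures_def using heisenberg_ext_alg by blast
qed

lemma heisenberg_ext_nilpotent: "nilpotent_alg heisenberg_ext"
proof (rule nilpotent_alg_if_class_le_4[OF heisenberg_ext_alg])
  let ?U = "{v. v $ 1 = 0 \<and> v $ 2 = 0} :: (complex ^ 4) set"
  let ?I = "{v. v $ 1 = 0 \<and> v $ 2 = 0 \<and> v $ 3 = 0} :: (complex ^ 4) set"
  show "vec.subspace ?U" "vec.subspace ?I"
    by (simp_all add: vec.subspace_def)
  show "heisenberg_ext x y \<in> ?U" for x y
    by simp
  show "heisenberg_ext x u \<in> ?I \<and> heisenberg_ext u x \<in> ?I" if "u \<in> ?U" for x u
    using that by simp
  show "heisenberg_ext x u = 0 \<and> heisenberg_ext u x = 0" if "u \<in> ?I" for x u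
    using that by (simp add: heisenberg_ext_def)
qed

lemma axis_4_nth:
  "axis (1::4) (1::complex) $ 1 = 1" "axis (1::4) (1::complex) $ 2 = 0"
  "axis (1::4) (1::complex) $ 3 = 0" "axis (1::4) (1::complex) $ 4 = 0"
  "axis (2::4) (1::complex) $ 1 = 0" "axis (2::4) (1::complex) $ 2 = 1"
  "axis (2::4) (1::complex) $ 3 = 0" "axis (2::4) (1::complex) $ 4 = 0"
  "axis (3::4) (1::complex) $ 1 = 0" "axis (3::4) (1::complex) $ 2 = 0"
  "axis (3::4) (1::complex) $ 3 = 1" "axis (3::4) (1::complex) $ 4 = 0"
  by (simp_all add: axis_def)

section \<open>Coordinates with respect to a frame\<close>

lemma leibniz_identity:
  "\<mu> \<in> leibniz_structures \<Longrightarrow> \<mu> (\<mu> x y) z = \<mu> (\<mu> x z) y + \<mu> x (\<mu> y z)"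
  unfolding leibniz_structures_def by blast

lemma leibniz_alg: "\<mu> \<in> leibniz_structures \<Longrightarrow> \<mu> \<in> alg_structures"
  unfolding leibniz_structures_def by blast

text \<open>In both extensions below \<open>v1\<close> spans the squares. Comparing frame
  coordinates turns an instance of the Leibniz identity into four scalar equations.\<close>

locale framed_leibniz =
  fixes \<mu> :: "4 alg" and v1 v2 v3 v4 :: "complex ^ 4"
  assumes leibniz: "\<mu> \<in> leibniz_structures"
    and spanning: "\<exists>a b c d. z = a *s v1 + b *s v2 + c *s v3 + d *s v4"
    and independent: "a *s v1 + b *s v2 + c *s v3 + d *s v4 = 0 \<Longrightarrow> a = 0 \<and> b = 0 \<and> c = 0 \<and> d = 0"
begin

definition V :: "complex \<Rightarrow> complex \<Rightarrow> complex \<Rightarrow> complex \<Rightarrow> complex ^ 4" where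
  "V a b c d = a *s v1 + b *s v2 + c *s v3 + d *s v4"

lemma V_add: "V a b c d + V a' b' c' d' = V (a + a') (b + b') (c + c') (d + d')"
  by (simp add: V_def vec_eq_iff algebra_simps)

lemma V_diff: "V a b c d - V a' b' c' d' = V (a - a') (b - b') (c - c') (d - d')"
  by (simp add: V_def vec_eq_iff algebra_simps)

lemma V_minus: "- V a b c d = V (- a) (- b) (- c) (- d)"
  by (simp add: V_def vec_eq_iff algebra_simps)

lemma V_scale: "k *s V a b c d = V (k * a) (k * b) (k * c) (k * d)"
  by (simp add: V_def vec_eq_iff algebra_simps)

lemma V_zero: "V 0 0 0 0 = 0"
  by (simp add: V_def)

lemma V_eq_0_iff: "V a b c d = 0 \<longleftrightarrow> a = 0 \<and> b = 0 \<and> c = 0 \<and> d = 0"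
  using independent[of a b c d] by (auto simp: V_def)

lemma V_eq_iff: "V a b c d = V a' b' c' d' \<longleftrightarrow> a = a' \<and> b = b' \<and> c = c' \<and> d = d'"
proof -
  have "V a b c d = V a' b' c' d' \<longleftrightarrow> V (a - a') (b - b') (c - c') (d - d') = 0"
    by (simp add: V_diff[symmetric])
  then show ?thesis
    by (simp add: V_eq_0_iff)
qed

lemmas V_simps = V_add V_diff V_minus V_scale

lemma V_cases: obtains a b c d where "z = V a b c d"
  using spanning[of z] unfolding V_def by blast

lemma linear_V:
  assumes "linear_form \<phi>"
  shows "\<phi> (V a b c d) = a * \<phi> v1 + b * \<phi> v2 + c * \<phi> v3 + d * \<phi> v4"
  using assms by (simp add: V_def linear_form_def)

lemmas bilinear = alg_structures_simps[OF leibniz_alg[OF leibniz]]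

lemma product_V:
  "\<mu> (V a b c d) (V a' b' c' d') =
     (a * a') *s \<mu> v1 v1 + (a * b') *s \<mu> v1 v2 + (a * c') *s \<mu> v1 v3 + (a * d') *s \<mu> v1 v4 +
     (b * a') *s \<mu> v2 v1 + (b * b') *s \<mu> v2 v2 + (b * c') *s \<mu> v2 v3 + (b * d') *s \<mu> v2 v4 +
     (c * a') *s \<mu> v3 v1 + (c * b') *s \<mu> v3 v2 + (c * c') *s \<mu> v3 v3 + (c * d') *s \<mu> v3 v4 +
     (d * a') *s \<mu> v4 v1 + (d * b') *s \<mu> v4 v2 + (d * c') *s \<mu> v4 v3 + (d * d') *s \<mu> v4 v4"
  unfolding V_def bilinear by (simp add: vec_eq_iff algebra_simps)

end

text \<open>
  The case where the algebra acts on the line \<open>\<complex> v1\<close> spanned by the squares through a nonzero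
  character: \<open>v2\<close> acts by 1, and \<open>v3, v4\<close> span the complement of the hyperbolic plane
  \<open>\<langle>v1, v2\<rangle>\<close> that is orthogonal with respect to the polarisation of \<open>x \<mapsto> xx\<close>. Right
  multiplication by \<open>v2\<close> acts on it by \<open>D = (d11, d12; d21, d22)\<close>, and \<open>b\<close> is the bracket of \<open>v3, v4\<close>.
\<close>

locale split_leibniz = framed_leibniz +
  fixes h1 h2 d11 d12 d21 d22 s1 s2 f12 f21 b1 b2 :: complex
  assumes table:
    "\<mu> v1 v1 = 0" "\<mu> v1 v2 = v1" "\<mu> v1 v3 = 0" "\<mu> v1 v4 = 0"
    "\<mu> v2 v1 = 0" "\<mu> v2 v2 = 0" "\<mu> v2 v3 = - V h1 0 d11 d21" "\<mu> v2 v4 = - V h2 0 d12 d22"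
    "\<mu> v3 v1 = 0" "\<mu> v3 v2 = V h1 0 d11 d21" "\<mu> v3 v3 = V s1 0 0 0" "\<mu> v3 v4 = V f12 0 b1 b2"
    "\<mu> v4 v1 = 0" "\<mu> v4 v2 = V h2 0 d12 d22" "\<mu> v4 v3 = V f21 0 (- b1) (- b2)" "\<mu> v4 v4 = V s2 0 0 0"
begin

lemma product_table:
  "\<mu> (V x1 x2 x3 x4) (V y1 y2 y3 y4) = V
     (x1 * y2 + h1 * (x3 * y2 - x2 * y3) + h2 * (x4 * y2 - x2 * y4) +
        s1 * x3 * y3 + s2 * x4 * y4 + f12 * x3 * y4 + f21 * x4 * y3)
     0
     (d11 * (x3 * y2 - x2 * y3) + d12 * (x4 * y2 - x2 * y4) + b1 * (x3 * y4 - x4 * y3))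
     (d21 * (x3 * y2 - x2 * y3) + d22 * (x4 * y2 - x2 * y4) + b2 * (x3 * y4 - x4 * y3))"
  unfolding product_V table
  unfolding V_def by (simp add: vec_eq_iff algebra_simps)

text \<open>Right multiplication by \<open>v2\<close> fixes \<open>v1\<close> while left
  multiplication kills it. Hence in \<open>(v2 v2) w = (v2 w) v2 + v2 (v2 w)\<close> everything
  cancels except the \<open>v1\<close>-part of \<open>v2 w\<close>.\<close>

lemma h_eq_0: "h1 = 0" "h2 = 0"
  using leibniz_identity[OF leibniz, of "V 0 1 0 0" "V 0 1 0 0" "V 0 0 1 0"]
    leibniz_identity[OF leibniz, of "V 0 1 0 0" "V 0 1 0 0" "V 0 0 0 1"]
  by (simp_all add: product_table V_simps V_eq_iff)

lemmas product_table' = product_table[unfolded h_eq_0, simplified]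

text \<open>
  With \<open>f\<close> the \<open>v1\<close>-component of the product on \<open>\<langle>v3, v4\<rangle>\<close>, the next three lemmas say
  \<open>f(w,w') = f(Dw,w') + f(w,Dw')\<close>, \<open>f(Dw,w') = f(Dw',w)\<close> together with \<open>Db = tr(D) b\<close>,
  and that \<open>b\<close> is in the radical of the symmetrisation of \<open>f\<close>.
\<close>

lemma f_derivation:
  "s1 = (d11 * s1 + d21 * f21) + (s1 * d11 + f12 * d21)"
  "f12 = (d11 * f12 + d21 * s2) + (s1 * d12 + f12 * d22)"
  "f21 = (d12 * s1 + d22 * f21) + (f21 * d11 + s2 * d21)"
  "s2 = (d12 * f12 + d22 * s2) + (f21 * d12 + s2 * d22)"
  using leibniz_identity[OF leibniz, of "V 0 0 1 0" "V 0 0 1 0" "V 0 1 0 0"]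
    leibniz_identity[OF leibniz, of "V 0 0 1 0" "V 0 0 0 1" "V 0 1 0 0"]
    leibniz_identity[OF leibniz, of "V 0 0 0 1" "V 0 0 1 0" "V 0 1 0 0"]
    leibniz_identity[OF leibniz, of "V 0 0 0 1" "V 0 0 0 1" "V 0 1 0 0"]
  by (simp_all add: product_table' V_simps V_eq_iff mult.commute add_ac)

lemma f_symmetry: "d11 * f12 + d21 * s2 = d12 * s1 + d22 * f21"
  and bracket_derivation: "d12 * b2 = d22 * b1" "d21 * b1 = d11 * b2"
proof -
  have "- (d21 * s2) - d11 * f12 = - (d12 * s1) - d22 * f21"
    "d12 * b2 = d22 * b1" "d21 * b1 = d11 * b2"
    using leibniz_identity[OF leibniz, of "V 0 1 0 0" "V 0 0 1 0" "V 0 0 0 1"]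
    by (simp_all add: product_table' V_simps V_eq_iff mult.commute)
  then show "d11 * f12 + d21 * s2 = d12 * s1 + d22 * f21"
    "d12 * b2 = d22 * b1" "d21 * b1 = d11 * b2"
    by (simp_all add: algebra_simps)
qed

lemma bracket_radical:
  "2 * s1 * b1 + (f12 + f21) * b2 = 0" "(f12 + f21) * b1 + 2 * s2 * b2 = 0"
proof -
  have "2 * (b1 * s1) + (f21 * b2 + f12 * b2) = 0" "- (f12 * b1) - f21 * b1 = 2 * (b2 * s2)"
    using leibniz_identity[OF leibniz, of "V 0 0 1 0" "V 0 0 1 0" "V 0 0 0 1"]
      leibniz_identity[OF leibniz, of "V 0 0 0 1" "V 0 0 0 1" "V 0 0 1 0"]
    by (simp_all add: product_table' V_simps V_eq_iff)
  then show "2 * s1 * b1 + (f12 + f21) * b2 = 0" "(f12 + f21) * b1 + 2 * s2 * b2 = 0"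
    by algebra+
qed

text \<open>Let g be the symmetrisation of f and M the matrix \<open>(d11, d12; d21, d22)\<close>.
  Replacing \<open>f(Mw,w')\<close> by \<open>f(Mw',w)\<close> in the derivation law gives
  \<open>f(w,w') = g(w,Mw')\<close>.\<close>

lemma f_eq:
  "s1 = 2 * s1 * d11 + (f12 + f21) * d21" "f12 = 2 * s1 * d12 + (f12 + f21) * d22"
  "f21 = (f12 + f21) * d11 + 2 * s2 * d21" "s2 = (f12 + f21) * d12 + 2 * s2 * d22"
proof -
  show "s1 = 2 * s1 * d11 + (f12 + f21) * d21"
    by (rule trans[OF f_derivation(1)]) (simp add: algebra_simps)
  show "f12 = 2 * s1 * d12 + (f12 + f21) * d22"
    by (rule trans[OF f_derivation(2)[unfolded f_symmetry]]) (simp add: algebra_simps)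
  show "f21 = (f12 + f21) * d11 + 2 * s2 * d21"
    by (rule trans[OF f_derivation(3)[folded f_symmetry]]) (simp add: algebra_simps)
  show "s2 = (f12 + f21) * d12 + 2 * s2 * d22"
    by (rule trans[OF f_derivation(4)]) (simp add: algebra_simps)
qed

text \<open>Cayley-Hamilton for M in \<open>f(w,w') = g(w,Mw')\<close> gives
  \<open>f(w,Mw') = T f(w,w') - D g(w,w')\<close>. The derivation law then determines
  \<open>f(Mw,w')\<close>, and its symmetry in \<open>w, w'\<close> allows the swap of arguments on
  the right.\<close>

lemma f_cayley_hamilton:
  defines "T \<equiv> d11 + d22" and "D \<equiv> d11 * d22 - d12 * d21"
  shows "d11 * s1 + d21 * f21 = D * s1 + (1 + D - T) * s1"
    "d11 * f12 + d21 * s2 = D * f12 + (1 + D - T) * f21"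
    "d12 * s1 + d22 * f21 = D * f21 + (1 + D - T) * f12"
    "d12 * f12 + d22 * s2 = D * s2 + (1 + D - T) * s2"
proof -
  have 1: "s1 * d11 + f12 * d21 = T * s1 - 2 * D * s1"
    using f_eq(1,2) unfolding T_def D_def by algebra
  have 2: "s1 * d12 + f12 * d22 = T * f12 - D * (f12 + f21)"
    using f_eq(1,2) unfolding T_def D_def by algebra
  have 3: "f21 * d11 + s2 * d21 = T * f21 - D * (f12 + f21)"
    using f_eq(3,4) unfolding T_def D_def by algebra
  have 4: "f21 * d12 + s2 * d22 = T * s2 - 2 * D * s2"
    using f_eq(3,4) unfolding T_def D_def by algebra
  have 5: "d11 * f12 + d21 * s2 = f12 - (T * f12 - D * (f12 + f21))"
    using f_derivation(2) unfolding 2 by (simp only: eq_diff_eq)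
  have 6: "d12 * s1 + d22 * f21 = f21 - (T * f21 - D * (f12 + f21))"
    using f_derivation(3) unfolding 3 by (simp only: eq_diff_eq)
  have 7: "f12 - (T * f12 - D * (f12 + f21)) = f21 - (T * f21 - D * (f12 + f21))"
    using f_symmetry unfolding 5 6 .
  show "d11 * s1 + d21 * f21 = D * s1 + (1 + D - T) * s1"
    using f_derivation(1) unfolding 1 by algebra
  show "d11 * f12 + d21 * s2 = D * f12 + (1 + D - T) * f21"
    unfolding 5 7 by (simp add: algebra_simps)
  show "d12 * s1 + d22 * f21 = D * f21 + (1 + D - T) * f12"
    unfolding 6 7[symmetric] by (simp add: algebra_simps)
  show "d12 * f12 + d22 * s2 = D * s2 + (1 + D - T) * s2"
    using f_derivation(4) unfolding 4 by algebra
qed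

text \<open>Without bracket, the \<open>v3, v4\<close>-part of \<open>\<mu> y x\<close> is M applied
  to a combination of the parts of \<open>x\<close> and \<open>y\<close>. There the identity is
  Cayley-Hamilton for M; in the \<open>v1\<close>-coordinate it is
  \<open>f_cayley_hamilton\<close>.\<close>

lemma linear_identity:
  fixes x y
  assumes "b1 = 0" "b2 = 0"
  defines "T \<equiv> d11 + d22" and "D \<equiv> d11 * d22 - d12 * d21"
  shows "\<exists>s t. \<mu> (\<mu> x x) x = s *s \<mu> x x \<and> \<mu> (\<mu> x x) y = t *s \<mu> x x \<and>
    \<mu> (\<mu> y x) x = ((1 + D) * s) *s \<mu> y x + ((1 + D - T) * s) *s \<mu> x y - (D * s\<^sup>2) *s y +
      (D * s * t) *s x + ((T - 1 - 2 * D) * t) *s \<mu> x x"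
proof -
  obtain x1 x2 x3 x4 where x: "x = V x1 x2 x3 x4" by (rule V_cases)
  obtain y1 y2 y3 y4 where y: "y = V y1 y2 y3 y4" by (rule V_cases)
  have 1: "\<mu> (\<mu> x x) x = x2 *s \<mu> x x" "\<mu> (\<mu> x x) y = y2 *s \<mu> x x"
    unfolding x y by (simp_all add: product_table' V_simps V_eq_iff algebra_simps)
  note ch = f_cayley_hamilton[folded T_def D_def]
  \<comment> \<open>The left side is the contribution \<open>x2 f(My,x) - y2 f(Mx,x)\<close> to the
    \<open>v1\<close>-coordinate of \<open>\<mu> (\<mu> y x) x\<close>; after this rewriting that
    coordinate is a ring identity.\<close>
  have "x2 * (y3 * x3 * (d11 * s1 + d21 * f21) + y3 * x4 * (d11 * f12 + d21 * s2) +
        y4 * x3 * (d12 * s1 + d22 * f21) + y4 * x4 * (d12 * f12 + d22 * s2)) -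
      y2 * (x3 * x3 * (d11 * s1 + d21 * f21) + x3 * x4 * (d11 * f12 + d21 * s2) +
        x4 * x3 * (d12 * s1 + d22 * f21) + x4 * x4 * (d12 * f12 + d22 * s2)) =
      x2 * (y3 * x3 * (D * s1 + (1 + D - T) * s1) + y3 * x4 * (D * f12 + (1 + D - T) * f21) +
        y4 * x3 * (D * f21 + (1 + D - T) * f12) + y4 * x4 * (D * s2 + (1 + D - T) * s2)) -
      y2 * (x3 * x3 * (D * s1 + (1 + D - T) * s1) + x3 * x4 * (D * f12 + (1 + D - T) * f21) +
        x4 * x3 * (D * f21 + (1 + D - T) * f12) + x4 * x4 * (D * s2 + (1 + D - T) * s2))"
    by (simp only: ch)
  then have "\<mu> (\<mu> y x) x = ((1 + D) * x2) *s \<mu> y x + ((1 + D - T) * x2) *s \<mu> x y - (D * x2\<^sup>2) *s y +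
      (D * x2 * y2) *s x + ((T - 1 - 2 * D) * y2) *s \<mu> x x"
    unfolding x y product_table' V_simps V_eq_iff assms(1,2)
    apply (intro conjI)
       subgoal by (simp add: algebra_simps power2_eq_square)
      subgoal by (simp add: algebra_simps power2_eq_square)
     subgoal unfolding T_def D_def by (simp add: algebra_simps power2_eq_square)
    subgoal unfolding T_def D_def by (simp add: algebra_simps power2_eq_square)
    done
  then show ?thesis using 1 by blast
qed

text \<open>A nonzero bracket b forces M to have image in the line of b and f to vanish. Then b is,
  modulo \<open>v1\<close>, an eigenvector of right multiplication by \<open>x\<close> with
  eigenvalue \<tau>, and what is left over lies on the line of \<open>v1\<close>. Here
  \<open>Q(x) = x1 x2\<close>, which gives the constant -1.\<close>

lemma quadratic_identity:
  fixes x y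
  assumes "b1 \<noteq> 0 \<or> b2 \<noteq> 0" and \<phi>: "linear_form \<phi>"
  shows "\<exists>s t \<tau>. \<mu> (\<mu> x x) x = s *s \<mu> x x \<and> \<mu> (\<mu> x x) y = t *s \<mu> x x \<and>
    \<mu> (\<mu> (\<mu> y x) x) x - s *s \<mu> (\<mu> y x) x = \<tau> *s (\<mu> (\<mu> y x) x - s *s \<mu> y x) \<and>
    (\<phi> (\<mu> (\<mu> y x) x - (\<tau> / 2) *s (\<mu> y x - \<mu> x y) - s *s (\<mu> x y + \<mu> y x) + t *s \<mu> x x))\<^sup>2 =
      - 1 * \<tau>\<^sup>2 * (\<phi> (\<mu> x x) * \<phi> (\<mu> y y) - (\<phi> (\<mu> x y + \<mu> y x))\<^sup>2 / 4)"
proof -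
  obtain x1 x2 x3 x4 where x: "x = V x1 x2 x3 x4" by (rule V_cases)
  obtain y1 y2 y3 y4 where y: "y = V y1 y2 y3 y4" by (rule V_cases)
  \<comment> \<open>By \<open>bracket_derivation\<close> both columns of M are proportional to
    b.\<close>
  obtain p q where D: "d11 = p * b1" "d21 = p * b2" "d12 = q * b1" "d22 = q * b2"
  proof (cases "b1 = 0")
    case True
    then show ?thesis
      using that[of "d21 / b2" "d22 / b2"] bracket_derivation assms(1) by simp
  next
    case False
    then show ?thesis
      using that[of "d11 / b1" "d12 / b1"] bracket_derivation by (simp add: field_simps)
  qed
  \<comment> \<open>These equations are \<open>f(w,w') = g(w,Mw')\<close> with \<open>Mw'\<close> a
    multiple of b, and b lies in the radical of g.\<close>
  have "s1 = p * (2 * s1 * b1 + (f12 + f21) * b2)" "f12 = q * (2 * s1 * b1 + (f12 + f21) * b2)"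
    "f21 = p * ((f12 + f21) * b1 + 2 * s2 * b2)" "s2 = q * ((f12 + f21) * b1 + 2 * s2 * b2)"
    using f_eq unfolding D by (simp_all only: algebra_simps)
  then have s0: "s1 = 0" "s2 = 0" "f12 = 0" "f21 = 0"
    unfolding bracket_radical by simp_all
  define n where "n = p * (y3 * x2 - y2 * x3) + q * (y4 * x2 - y2 * x4) + (y3 * x4 - y4 * x3)"
  define \<tau> where "\<tau> = p * b1 * x2 + q * b2 * x2 + b1 * x4 - b2 * x3"
  have yx: "\<mu> y x = V (y1 * x2) 0 (n * b1) (n * b2)"
    unfolding x y product_table' V_eq_iff s0 D n_def by (simp add: algebra_simps)
  have xy: "\<mu> x y = V (x1 * y2) 0 (- n * b1) (- n * b2)"
    unfolding x y product_table' V_eq_iff s0 D n_def by (simp add: algebra_simps)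
  have xx: "\<mu> x x = V (x1 * x2) 0 0 0" and yy: "\<mu> y y = V (y1 * y2) 0 0 0"
    unfolding x y product_table' V_eq_iff s0 by simp_all
  have m: "\<mu> (V a 0 (k * b1) (k * b2)) x = V (a * x2) 0 ((\<tau> * k) * b1) ((\<tau> * k) * b2)" for a k
    unfolding x product_table' V_eq_iff s0 D \<tau>_def by (simp add: algebra_simps)
  have 1: "\<mu> (\<mu> x x) x = x2 *s \<mu> x x" "\<mu> (\<mu> x x) y = y2 *s \<mu> x x"
    unfolding x y by (simp_all add: product_table' V_simps V_eq_iff algebra_simps)
  have 2: "\<mu> (\<mu> (\<mu> y x) x) x - x2 *s \<mu> (\<mu> y x) x = \<tau> *s (\<mu> (\<mu> y x) x - x2 *s \<mu> y x)"
    unfolding yx m V_simps V_eq_iff by (simp add: algebra_simps)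
  have N: "\<mu> (\<mu> y x) x - (\<tau> / 2) *s (\<mu> y x - \<mu> x y) - x2 *s (\<mu> x y + \<mu> y x) + y2 *s \<mu> x x =
      V (- \<tau> / 2 * (y1 * x2 - x1 * y2)) 0 0 0"
    unfolding yx xy xx m V_simps V_eq_iff by (simp add: algebra_simps)
  have 3: "(\<phi> (\<mu> (\<mu> y x) x - (\<tau> / 2) *s (\<mu> y x - \<mu> x y) - x2 *s (\<mu> x y + \<mu> y x) + y2 *s \<mu> x x))\<^sup>2 =
      - 1 * \<tau>\<^sup>2 * (\<phi> (\<mu> x x) * \<phi> (\<mu> y y) - (\<phi> (\<mu> x y + \<mu> y x))\<^sup>2 / 4)"
    unfolding N unfolding yx xy xx yy V_simps linear_V[OF \<phi>]
    by (simp add: field_simps power2_eq_square)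
  show ?thesis using 1 2 3 by blast
qed

end

text \<open>
  The case where the line of squares \<open>\<complex> v1\<close> is central; \<open>v2, v3, v4\<close> is orthogonal with respect to
  the polarisation of \<open>x \<mapsto> xx\<close>, which is invariant under the Lie quotient by \<open>\<complex> v1\<close>.
\<close>

locale central_leibniz = framed_leibniz +
  fixes n m1 m2 m3 s p1 p2 p3 t q1 q2 q3 \<gamma> \<delta> :: complex
  assumes \<gamma>: "\<gamma> \<noteq> 0"
    and table:
    "\<mu> v1 v1 = 0" "\<mu> v1 v2 = 0" "\<mu> v1 v3 = 0" "\<mu> v1 v4 = 0"
    "\<mu> v2 v1 = 0" "\<mu> v2 v2 = v1" "\<mu> v2 v3 = V n m1 m2 m3" "\<mu> v2 v4 = - V s p1 p2 p3"
    "\<mu> v3 v1 = 0" "\<mu> v3 v2 = - V n m1 m2 m3" "\<mu> v3 v3 = V \<gamma> 0 0 0" "\<mu> v3 v4 = - V t q1 q2 q3"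
    "\<mu> v4 v1 = 0" "\<mu> v4 v2 = V s p1 p2 p3" "\<mu> v4 v3 = V t q1 q2 q3" "\<mu> v4 v4 = V \<delta> 0 0 0"
begin

lemma product_table:
  "\<mu> (V x1 x2 x3 x4) (V y1 y2 y3 y4) = V
     (x2 * y2 + \<gamma> * x3 * y3 + \<delta> * x4 * y4 + n * (x2 * y3 - x3 * y2) + s * (x4 * y2 - x2 * y4) + t * (x4 * y3 - x3 * y4))
     (m1 * (x2 * y3 - x3 * y2) + p1 * (x4 * y2 - x2 * y4) + q1 * (x4 * y3 - x3 * y4))
     (m2 * (x2 * y3 - x3 * y2) + p2 * (x4 * y2 - x2 * y4) + q2 * (x4 * y3 - x3 * y4))
     (m3 * (x2 * y3 - x3 * y2) + p3 * (x4 * y2 - x2 * y4) + q3 * (x4 * y3 - x3 * y4))"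
  unfolding product_V table
  unfolding V_def by (simp add: vec_eq_iff algebra_simps)

text \<open>Squares are central, so \<open>0 = (zz)w = (zw)z + z(zw)\<close>: the product
  \<open>zw\<close> is orthogonal to \<open>z\<close>. The factor \<delta> stays because it may
  vanish.\<close>

lemma bracket_orthogonal: "m1 = 0" "m2 = 0" "p1 = 0" "q2 = 0" "\<delta> * p3 = 0" "\<delta> * q3 = 0"
  using leibniz_identity[OF leibniz, of "V 0 1 0 0" "V 0 1 0 0" "V 0 0 1 0"]
    leibniz_identity[OF leibniz, of "V 0 0 1 0" "V 0 0 1 0" "V 0 1 0 0"]
    leibniz_identity[OF leibniz, of "V 0 1 0 0" "V 0 1 0 0" "V 0 0 0 1"]
    leibniz_identity[OF leibniz, of "V 0 0 1 0" "V 0 0 1 0" "V 0 0 0 1"]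
    leibniz_identity[OF leibniz, of "V 0 0 0 1" "V 0 0 0 1" "V 0 1 0 0"]
    leibniz_identity[OF leibniz, of "V 0 0 0 1" "V 0 0 0 1" "V 0 0 1 0"]
  by (simp_all add: product_table V_simps V_eq_iff V_eq_0_iff \<gamma>)

lemmas product_table' = product_table[unfolded bracket_orthogonal, simplified]

text \<open>The first two equations express the invariance of the polarised form under the bracket;
  the third ties its value to \<open>s, t\<close>, the skew part of the
  \<open>v1\<close>-coordinate.\<close>

lemma bracket_eq: "p2 * \<gamma> = m3 * \<delta>" "q1 = - (p2 * \<gamma>)" "m3 * \<delta> = q3 * s - p3 * t"
proof -
  have 1: "m3 * \<delta> = - (p2 * \<gamma>) - p3 * t - q1 + q3 * s"
    using leibniz_identity[OF leibniz, of "V 0 1 0 0" "V 0 0 1 0" "V 0 0 0 1"]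
    by (simp add: product_table' V_simps V_eq_iff algebra_simps)
  have 2: "- (m3 * \<delta>) = - q1 - q3 * s - p2 * \<gamma> + p3 * t"
    using leibniz_identity[OF leibniz, of "V 0 0 1 0" "V 0 1 0 0" "V 0 0 0 1"]
    by (simp add: product_table' V_simps V_eq_iff algebra_simps)
  have 3: "p2 * \<gamma> + p3 * t = q1 + q3 * s + m3 * \<delta>"
    using leibniz_identity[OF leibniz, of "V 0 0 0 1" "V 0 1 0 0" "V 0 0 1 0"]
    by (simp add: product_table' V_simps V_eq_iff algebra_simps)
  show "p2 * \<gamma> = m3 * \<delta>" "q1 = - (p2 * \<gamma>)" "m3 * \<delta> = q3 * s - p3 * t"
    using 1 2 3 by algebra+
qed

lemma subspace_V:
  "vec.subspace {V a 0 0 0 | a. True}" "vec.subspace {V a 0 0 b | a b. True}"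
proof -
  show "vec.subspace {V a 0 0 0 | a. True}"
    unfolding vec.subspace_def
  proof (intro conjI allI ballI)
    show "0 \<in> {V a 0 0 0 | a. True}"
      using V_zero by force
  qed (auto simp: V_simps V_eq_iff)
  show "vec.subspace {V a 0 0 b | a b. True}"
    unfolding vec.subspace_def
  proof (intro conjI allI ballI)
    show "0 \<in> {V a 0 0 b | a b. True}"
      using V_zero by force
  qed (auto simp: V_simps V_eq_iff)
qed

text \<open>If \<delta> is nonzero, all products fall into the central line of \<open>v1\<close>. If
  \<delta> = 0, they fall into the span of \<open>v1, v4\<close>, and right multiplication acts on
  \<open>v4\<close> modulo \<open>v1\<close> through \<open>p3, q3\<close>. When these do not both
  vanish, \<open>q3 * s = p3 * t\<close> makes \<open>(s, t)\<close> proportional to them.\<close>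

lemma nilpotent_or:
  "nilpotent_alg \<mu> \<or> \<delta> = 0 \<and> p2 = 0 \<and> q1 = 0 \<and> (p3 \<noteq> 0 \<or> q3 \<noteq> 0) \<and> (\<exists>\<sigma>. s = \<sigma> * p3 \<and> t = \<sigma> * q3)"
proof (cases "\<delta> = 0")
  case True
  then have 0: "p2 = 0" "q1 = 0" "q3 * s = p3 * t"
    using bracket_eq \<gamma> by simp_all
  show ?thesis
  proof (cases "p3 = 0 \<and> q3 = 0")
    case p: True
    have "nilpotent_alg \<mu>"
    proof (rule nilpotent_alg_if_class_le_4[OF leibniz_alg[OF leibniz] subspace_V(2) _ subspace_V(1)])
      fix x u
      obtain x1 x2 x3 x4 where x: "x = V x1 x2 x3 x4" by (rule V_cases)
      obtain u1 u2 u3 u4 where u: "u = V u1 u2 u3 u4" by (rule V_cases)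
      show "\<mu> x u \<in> {V a 0 0 b | a b. True}"
        unfolding x u by (simp add: product_table' V_eq_iff 0 p)
      show "\<mu> x u \<in> {V a 0 0 0 | a. True} \<and> \<mu> u x \<in> {V a 0 0 0 | a. True}"
        if "u \<in> {V a 0 0 b | a b. True}"
        using that unfolding x by (auto simp: product_table' V_eq_iff 0 p)
      show "\<mu> x u = 0 \<and> \<mu> u x = 0" if "u \<in> {V a 0 0 0 | a. True}"
        using that unfolding x by (auto simp: product_table' V_eq_0_iff)
    qed
    then show ?thesis ..
  next
    case False
    have "\<exists>\<sigma>. s = \<sigma> * p3 \<and> t = \<sigma> * q3"
    proof (cases "p3 = 0")
      case True
      then show ?thesis using False 0(3) by (intro exI[of _ "t / q3"]) simp
    next
      case False
      then show ?thesis using 0(3) by (intro exI[of _ "s / p3"]) (simp add: field_simps)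
    qed
    then show ?thesis using False True 0 by blast
  qed
next
  case False
  then have 0: "p3 = 0" "q3 = 0" "m3 = 0" "p2 = 0" "q1 = 0"
    using bracket_orthogonal bracket_eq \<gamma> by auto
  have "nilpotent_alg \<mu>"
  proof (rule nilpotent_alg_if_class_le_4[OF leibniz_alg[OF leibniz] subspace_V(1) _ subspace_V(1)])
    fix x u
    obtain x1 x2 x3 x4 where x: "x = V x1 x2 x3 x4" by (rule V_cases)
    obtain u1 u2 u3 u4 where u: "u = V u1 u2 u3 u4" by (rule V_cases)
    show 1: "\<mu> x u \<in> {V a 0 0 0 | a. True}"
      unfolding x u by (simp add: product_table' V_eq_iff 0)
    show 2: "\<mu> x u = 0 \<and> \<mu> u x = 0" if "u \<in> {V a 0 0 0 | a. True}"
      using that unfolding x by (auto simp: product_table' V_eq_0_iff)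
    show "\<mu> x u \<in> {V a 0 0 0 | a. True} \<and> \<mu> u x \<in> {V a 0 0 0 | a. True}"
      if "u \<in> {V a 0 0 0 | a. True}"
      using 1 2[OF that] by simp
  qed
  then show ?thesis ..
qed

text \<open>Right multiplication by \<open>x\<close> sends \<open>v4\<close> to \<tau> times
  \<open>\<sigma> v1 + v4\<close> and kills \<open>v1\<close>. So \<open>a = b = 0\<close>, and the
  remainder is a multiple of \<open>v1\<close> whose square is compared with a Gram
  determinant.\<close>

lemma quadratic_identity:
  assumes "\<delta> = 0" "p2 = 0" "q1 = 0" "s = \<sigma> * p3" "t = \<sigma> * q3"
    and \<phi>: "linear_form \<phi>"
  shows "\<exists>a b \<tau>. \<mu> (\<mu> x x) x = a *s \<mu> x x \<and> \<mu> (\<mu> x x) y = b *s \<mu> x x \<and>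
    \<mu> (\<mu> (\<mu> y x) x) x - a *s \<mu> (\<mu> y x) x = \<tau> *s (\<mu> (\<mu> y x) x - a *s \<mu> y x) \<and>
    (\<phi> (\<mu> (\<mu> y x) x - (\<tau> / 2) *s (\<mu> y x - \<mu> x y) - a *s (\<mu> x y + \<mu> y x) + b *s \<mu> x x))\<^sup>2 =
      ((m3 * \<sigma> - n)\<^sup>2 / \<gamma>) * \<tau>\<^sup>2 * (\<phi> (\<mu> x x) * \<phi> (\<mu> y y) - (\<phi> (\<mu> x y + \<mu> y x))\<^sup>2 / 4)"
proof -
  obtain x1 x2 x3 x4 where x: "x = V x1 x2 x3 x4" by (rule V_cases)
  obtain y1 y2 y3 y4 where y: "y = V y1 y2 y3 y4" by (rule V_cases)
  note p = product_table'[unfolded assms(1-5), simplified]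
  define \<omega> where "\<omega> = y2 * x3 - y3 * x2"
  define \<tau> where "\<tau> = p3 * x2 + q3 * x3"
  define \<eta> where "\<eta> = y4 * \<tau> - x4 * (p3 * y2 + q3 * y3)"
  define S where "S = x2 * y2 + \<gamma> * x3 * y3"
  have yx: "\<mu> y x = V (S + \<omega> * n + \<eta> * \<sigma>) 0 0 (\<omega> * m3 + \<eta>)"
    and xy: "\<mu> x y = V (S - \<omega> * n - \<eta> * \<sigma>) 0 0 (- (\<omega> * m3 + \<eta>))"
    and xx: "\<mu> x x = V (x2 * x2 + \<gamma> * x3 * x3) 0 0 0"
    and yy: "\<mu> y y = V (y2 * y2 + \<gamma> * y3 * y3) 0 0 0"
    unfolding x y p V_eq_iff S_def \<omega>_def \<tau>_def \<eta>_def by (simp_all add: algebra_simps)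
  have m: "\<mu> (V a 0 0 k) x = V (k * \<tau> * \<sigma>) 0 0 (k * \<tau>)" "\<mu> (V a 0 0 0) y = 0" for a k
    unfolding x y p V_eq_iff V_eq_0_iff \<tau>_def by (simp_all add: algebra_simps)
  have 1: "\<mu> (\<mu> x x) x = 0 *s \<mu> x x" "\<mu> (\<mu> x x) y = 0 *s \<mu> x x"
    unfolding xx m by (simp_all add: V_zero)
  have 2: "\<mu> (\<mu> (\<mu> y x) x) x - 0 *s \<mu> (\<mu> y x) x = \<tau> *s (\<mu> (\<mu> y x) x - 0 *s \<mu> y x)"
    unfolding yx m V_simps V_eq_iff by (simp add: algebra_simps)
  have N: "\<mu> (\<mu> y x) x - (\<tau> / 2) *s (\<mu> y x - \<mu> x y) - 0 *s (\<mu> x y + \<mu> y x) + 0 *s \<mu> x x =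
      V (\<tau> * \<omega> * (m3 * \<sigma> - n)) 0 0 0"
    unfolding yx xy xx m V_simps V_eq_iff by (simp add: algebra_simps)
  \<comment> \<open>Lagrange's identity for the diagonal form with entries 1 and \<gamma>.\<close>
  have G: "\<phi> (\<mu> x x) * \<phi> (\<mu> y y) - (\<phi> (\<mu> x y + \<mu> y x))\<^sup>2 / 4 = \<gamma> * \<omega>\<^sup>2 * (\<phi> v1)\<^sup>2"
    unfolding yx xy xx yy V_simps linear_V[OF \<phi>] S_def \<omega>_def
    by (simp add: field_simps power2_eq_square)
  have 3: "(\<phi> (\<mu> (\<mu> y x) x - (\<tau> / 2) *s (\<mu> y x - \<mu> x y) - 0 *s (\<mu> x y + \<mu> y x) + 0 *s \<mu> x x))\<^sup>2 =
      ((m3 * \<sigma> - n)\<^sup>2 / \<gamma>) * \<tau>\<^sup>2 * (\<phi> (\<mu> x x) * \<phi> (\<mu> y y) - (\<phi> (\<mu> x y + \<mu> y x))\<^sup>2 / 4)"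
    unfolding N G linear_V[OF \<phi>] using \<gamma>
    by (simp add: power_mult_distrib)
  show ?thesis using 1 2 3 by blast
qed

end

section \<open>Obstructions to degeneration\<close>

definition is_frame :: "complex ^ 4 \<Rightarrow> complex ^ 4 \<Rightarrow> complex ^ 4 \<Rightarrow> complex ^ 4 \<Rightarrow> bool" where
  "is_frame a b c d \<longleftrightarrow>
     (\<forall>z. \<exists>k1 k2 k3 k4. z = k1 *s a + k2 *s b + k3 *s c + k4 *s d) \<and>
     (\<forall>k1 k2 k3 k4. k1 *s a + k2 *s b + k3 *s c + k4 *s d = 0 \<longrightarrow>
        k1 = 0 \<and> k2 = 0 \<and> k3 = 0 \<and> k4 = 0)"

lemma framed_leibnizI:
  "\<mu> \<in> leibniz_structures \<Longrightarrow> is_frame a b c d \<Longrightarrow> framed_leibniz \<mu> a b c d"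
  unfolding is_frame_def framed_leibniz_def by blast

lemma ex_notin_span3: "\<exists>d. d \<notin> vec.span {c, b, a :: complex ^ 4}"
proof (rule ccontr)
  assume "\<not> ?thesis"
  then have "vec.dim (UNIV :: (complex ^ 4) set) \<le> card {c, b, a}"
    by (intro vec.dim_le_card) auto
  then have "CARD(4) \<le> card {c, b, a}"
    unfolding vec_dim_card .
  moreover have "card {c, b, a} \<le> 3"
    using card_length[of "[c, b, a]"] by simp
  ultimately show False
    by simp
qed

lemma span3_notin:
  assumes "d \<notin> vec.span {c, b, a :: complex ^ 4}" "k1 *s a + k2 *s b + k3 *s c + k4 *s d = 0"
  shows "k4 = 0"
proof (rule ccontr)
  assume "k4 \<noteq> 0"
  moreover have "k4 *s d = - (k1 *s a + k2 *s b + k3 *s c)"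
    using assms(2) by (metis add.commute eq_neg_iff_add_eq_0)
  moreover have "d = (1 / k4) *s (k4 *s d)"
    using \<open>k4 \<noteq> 0\<close> by simp
  ultimately have "d = (1 / k4) *s (- (k1 *s a + k2 *s b + k3 *s c))"
    by simp
  moreover have "(1 / k4) *s (- (k1 *s a + k2 *s b + k3 *s c)) \<in> vec.span {c, b, a}"
    by (intro vec.span_scale vec.span_neg vec.span_add) (simp_all add: vec.span_base)
  ultimately show False
    using assms(1) by simp
qed

lemma is_frameI:
  assumes a: "a \<noteq> 0" and b: "b \<notin> vec.span {a}" and c: "c \<notin> vec.span {b, a}"
    and d: "d \<notin> vec.span {c, b, a}"
  shows "is_frame a b c d"
proof -
  have ind: "vec.independent {d, c, b, a}"
    by (intro vec.independent_insertI assms) (use a in \<open>simp_all add: vec.independent_empty\<close>)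
  have ne: "b \<noteq> a" "c \<noteq> a" "c \<noteq> b" "d \<noteq> a" "d \<noteq> b" "d \<noteq> c"
    using b c d vec.span_base[of a "{a}"] vec.span_base[of _ "{b, a}"] vec.span_base[of _ "{c, b, a}"]
    by auto
  have "vec.dim (UNIV :: (complex ^ 4) set) \<le> card {d, c, b, a}"
    unfolding vec_dim_card using ne by simp
  then have sp: "UNIV \<subseteq> vec.span {d, c, b, a}"
    by (intro vec.card_ge_dim_independent ind) simp_all
  have "\<exists>k1 k2 k3 k4. z = k1 *s a + k2 *s b + k3 *s c + k4 *s d" for z
  proof -
    have "z \<in> vec.span {d, c, b, a}"
      using sp by blast
    then obtain k1 k2 k3 k4 where "z - k4 *s d - k3 *s c - k2 *s b - k1 *s a = 0"
      unfolding vec.span_breakdown_eq vec.span_empty by auto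
    then have "z = k1 *s a + k2 *s b + k3 *s c + k4 *s d"
      by (simp add: algebra_simps)
    then show ?thesis by blast
  qed
  moreover have "k1 = 0 \<and> k2 = 0 \<and> k3 = 0 \<and> k4 = 0"
    if 0: "k1 *s a + k2 *s b + k3 *s c + k4 *s d = 0" for k1 k2 k3 k4
  proof -
    have 4: "k4 = 0"
      by (rule span3_notin[OF d 0])
    \<comment> \<open>Repeating \<open>a\<close> with coefficient 0 lets \<open>span3_notin\<close>
      treat the shorter relations too.\<close>
    have "0 *s a + k1 *s a + k2 *s b + k3 *s c = 0"
      using 0 4 by simp
    then have 3: "k3 = 0"
      using c by (intro span3_notin[of c b a a 0 k1 k2 k3]) (simp_all add: insert_commute)
    have "0 *s a + 0 *s a + k1 *s a + k2 *s b = 0"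
      using 0 4 3 by simp
    then have 2: "k2 = 0"
      using b by (intro span3_notin[of b a a a 0 0 k1 k2]) simp_all
    then show ?thesis
      using 0 a 2 3 4 by simp
  qed
  ultimately show ?thesis
    unfolding is_frame_def by blast
qed

text \<open>This is the change of frame used to orthogonalise later frame vectors against earlier
  ones.\<close>

lemma is_frame_shear:
  assumes "is_frame a b c d"
  shows "is_frame a b (c + r *s a + r' *s b) (d + s *s a + s' *s b + s'' *s c)"
  unfolding is_frame_def
proof (intro conjI allI impI)
  fix z
  obtain k1 k2 k3 k4 where "z = k1 *s a + k2 *s b + k3 *s c + k4 *s d"
    using assms unfolding is_frame_def by blast
  then have "z = (k1 - (k3 - k4 * s'') * r - k4 * s) *s a + (k2 - (k3 - k4 * s'') * r' - k4 * s') *s b +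
      (k3 - k4 * s'') *s (c + r *s a + r' *s b) + k4 *s (d + s *s a + s' *s b + s'' *s c)"
    by (simp add: vec_eq_iff algebra_simps)
  then show "\<exists>k1 k2 k3 k4. z = k1 *s a + k2 *s b + k3 *s (c + r *s a + r' *s b) +
      k4 *s (d + s *s a + s' *s b + s'' *s c)"
    by blast
next
  fix k1 k2 k3 k4
  assume 0: "k1 *s a + k2 *s b + k3 *s (c + r *s a + r' *s b) + k4 *s (d + s *s a + s' *s b + s'' *s c) = 0"
  then have "(k1 + k3 * r + k4 * s) *s a + (k2 + k3 * r' + k4 * s') *s b + (k3 + k4 * s'') *s c + k4 *s d = 0"
    by (simp add: vec_eq_iff algebra_simps)
  then have "k1 + k3 * r + k4 * s = 0 \<and> k2 + k3 * r' + k4 * s' = 0 \<and> k3 + k4 * s'' = 0 \<and> k4 = 0"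
    using assms unfolding is_frame_def by blast
  then show "k1 = 0" "k2 = 0" "k3 = 0" "k4 = 0"
    by auto
qed

section \<open>Polynomial conditions on an orbit that fail at the special algebra\<close>

lemma orbit_transport:
  assumes "\<mu>' \<in> orbit \<mu>"
  shows "\<exists>h g. (\<forall>v. h (g v) = v) \<and> (\<forall>v. g (h v) = v) \<and> (\<forall>x y. \<mu>' x y = g (\<mu> (h x) (h y))) \<and>
    (\<forall>x y. g (x + y) = g x + g y) \<and> (\<forall>c x. g (c *s x) = c *s g x) \<and> g 0 = 0"
proof -
  obtain g where g: "Vector_Spaces.linear (*s) (*s) g" "bij g" and \<mu>': "\<mu>' = alg_action g \<mu>"
    using assms unfolding orbit_def general_linear_def by blast
  have "\<forall>v. inv g (g v) = v" "\<forall>v. g (inv g v) = v"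
    using g(2) by (simp_all add: bij_is_inj bij_is_surj surj_f_inv_f)
  then show ?thesis
    by (intro exI[of _ "inv g"] exI[of _ g])
      (simp add: \<mu>' alg_action_def vec.linear_add[OF g(1)] vec.linear_scale[OF g(1)] vec.linear_0[OF g(1)])
qed

text \<open>The scalars \<open>a, b\<close> vary with the vectors, but \<open>k1\<close> to
  \<open>k5\<close> are fixed on the whole orbit. In the fourth coordinate the \<open>k3\<close> and
  \<open>k4\<close> terms drop out, since they are multiples of \<open>axis 2 1\<close> and
  \<open>axis 1 1\<close>. The resulting polynomial is 1 at \<open>heisenberg_ext\<close>.\<close>

lemma no_degeneration_if_linear_identity:
  assumes deg: "degenerates_to \<mu> heisenberg_ext"
    and id: "\<And>x y. \<exists>a b. \<mu> (\<mu> x x) x = a *s \<mu> x x \<and> \<mu> (\<mu> x x) y = b *s \<mu> x x \<and>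
      \<mu> (\<mu> y x) x = (k1 * a) *s \<mu> y x + (k2 * a) *s \<mu> x y - (k3 * a\<^sup>2) *s y +
        (k4 * a * b) *s x + (k5 * b) *s \<mu> x x"
  shows False
proof -
  let ?e1 = "axis 1 1 :: complex ^ 4" and ?e2 = "axis 2 1 :: complex ^ 4"
  \<comment> \<open>the assumed identity times the square of \<open>\<mu> x x\<close>, so that \<open>a\<close> and \<open>b\<close> are absorbed\<close>
  define F :: "4 alg \<Rightarrow> complex" where
    "F \<mu> = (\<mu> ?e1 ?e1 $ 4)\<^sup>2 * (\<mu> (\<mu> ?e2 ?e1) ?e1 $ 4) -
      (\<mu> ?e1 ?e1 $ 4) * (\<mu> (\<mu> ?e1 ?e1) ?e1 $ 4) * (k1 * (\<mu> ?e2 ?e1 $ 4) + k2 * (\<mu> ?e1 ?e2 $ 4)) -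
      k5 * (\<mu> ?e1 ?e1 $ 4)\<^sup>2 * (\<mu> (\<mu> ?e1 ?e1) ?e2 $ 4)" for \<mu>
  have "regular_fun F"
    unfolding F_def by (intro regular_intros)
  moreover have "F \<mu>' = 0" if orb: "\<mu>' \<in> orbit \<mu>" for \<mu>'
  proof -
    obtain h g where "\<forall>v. h (g v) = v" "\<forall>v. g (h v) = v" "\<forall>x y. \<mu>' x y = g (\<mu> (h x) (h y))"
      "\<forall>x y. g (x + y) = g x + g y" "\<forall>c x. g (c *s x) = c *s g x" "g 0 = 0"
      using orbit_transport[OF orb] by blast
    note g = this[rule_format]
    obtain a b where ab: "\<mu> (\<mu> (h ?e1) (h ?e1)) (h ?e1) = a *s \<mu> (h ?e1) (h ?e1)"
      "\<mu> (\<mu> (h ?e1) (h ?e1)) (h ?e2) = b *s \<mu> (h ?e1) (h ?e1)"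
      "\<mu> (\<mu> (h ?e2) (h ?e1)) (h ?e1) = (k1 * a) *s \<mu> (h ?e2) (h ?e1) + (k2 * a) *s \<mu> (h ?e1) (h ?e2) +
        (- (k3 * a\<^sup>2)) *s h ?e2 + (k4 * a * b) *s h ?e1 + (k5 * b) *s \<mu> (h ?e1) (h ?e1)"
      using id[of "h ?e1" "h ?e2"] by auto
    show ?thesis
      unfolding F_def g(1,3) ab g(2,4,5)
      by (simp add: axis_4_nth power2_eq_square algebra_simps)
  qed
  ultimately have "F heisenberg_ext = 0"
    using regular_fun_vanishes_at_degeneration[OF deg] by blast
  then show False
    by (simp add: F_def axis_4_nth)
qed

text \<open>At \<open>heisenberg_ext\<close> the eigenvalue quotient is 0, so the right side of the
  cleared identity vanishes, whereas \<open>(e2 e1) e1 = e4\<close> makes the left side 1.\<close>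

lemma no_degeneration_if_quadratic_identity:
  assumes deg: "degenerates_to \<mu> heisenberg_ext"
    and id: "\<And>x y \<phi>. linear_form \<phi> \<Longrightarrow>
    \<exists>a b \<tau>. \<mu> (\<mu> x x) x = a *s \<mu> x x \<and> \<mu> (\<mu> x x) y = b *s \<mu> x x \<and>
    \<mu> (\<mu> (\<mu> y x) x) x - a *s \<mu> (\<mu> y x) x = \<tau> *s (\<mu> (\<mu> y x) x - a *s \<mu> y x) \<and>
    (\<phi> (\<mu> (\<mu> y x) x - (\<tau> / 2) *s (\<mu> y x - \<mu> x y) - a *s (\<mu> x y + \<mu> y x) + b *s \<mu> x x))\<^sup>2 =
      \<kappa> * \<tau>\<^sup>2 * (\<phi> (\<mu> x x) * \<phi> (\<mu> y y) - (\<phi> (\<mu> x y + \<mu> y x))\<^sup>2 / 4)"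
  shows False
proof -
  let ?e1 = "axis 1 1 :: complex ^ 4" and ?e2 = "axis 2 1 :: complex ^ 4"
  \<comment> \<open>the assumed identity with \<open>a, b, \<tau>\<close> expressed as quotients of covariants, denominators cleared\<close>
  define P where "P q q' p e1 e2 e3 h h' = 
      ((q * e2 - h * e1) * q * e2 - (1 / 2) * q * (q * e3 - h * e2) * (e1 - p) -
        h * (q * e2 - h * e1) * (p + e1) + h' * (q * e2 - h * e1) * q)\<^sup>2 -
      \<kappa> * q\<^sup>2 * (q * e3 - h * e2)\<^sup>2 * (q * q' - (1 / 4) * (p + e1)\<^sup>2)"
    for q q' p e1 e2 e3 h h' :: complex
  \<comment> \<open>The arguments of \<open>P\<close> encode \<open>a = h / q\<close>,
    \<open>b = h' / q\<close> and
    \<open>\<tau> = (q * e3 - h * e2) / (q * e2 - h * e1)\<close>.\<close>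
  define F :: "4 alg \<Rightarrow> complex" where
    "F \<mu> = P (\<mu> ?e1 ?e1 $ 4) (\<mu> ?e2 ?e2 $ 4) (\<mu> ?e1 ?e2 $ 4) (\<mu> ?e2 ?e1 $ 4)
      (\<mu> (\<mu> ?e2 ?e1) ?e1 $ 4) (\<mu> (\<mu> (\<mu> ?e2 ?e1) ?e1) ?e1 $ 4)
      (\<mu> (\<mu> ?e1 ?e1) ?e1 $ 4) (\<mu> (\<mu> ?e1 ?e1) ?e2 $ 4)" for \<mu>
  have "regular_fun F"
    unfolding F_def P_def by (intro regular_intros)
  moreover have "F \<mu>' = 0" if orb: "\<mu>' \<in> orbit \<mu>" for \<mu>'
  proof -
    obtain h g where "\<forall>v. h (g v) = v" "\<forall>v. g (h v) = v" "\<forall>x y. \<mu>' x y = g (\<mu> (h x) (h y))"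
      "\<forall>x y. g (x + y) = g x + g y" "\<forall>c x. g (c *s x) = c *s g x" "g 0 = 0"
      using orbit_transport[OF orb] by blast
    note g = this[rule_format]
    define \<phi> where "\<phi> v = g v $ 4" for v
    have \<phi>: "linear_form \<phi>"
      unfolding linear_form_def \<phi>_def by (simp add: g(4,5))
    have lin: "\<phi> (u + v) = \<phi> u + \<phi> v" "\<phi> (u - v) = \<phi> u - \<phi> v" "\<phi> (c *s u) = c * \<phi> u" for u v c
    proof -
      show 1: "\<phi> (u + v) = \<phi> u + \<phi> v" "\<phi> (c *s u) = c * \<phi> u" for u v c
        using \<phi> unfolding linear_form_def by blast+
      show "\<phi> (u - v) = \<phi> u - \<phi> v"
        using 1(1)[of "u - v" v] by simp
    qed
    define x y where "x = h ?e1" and "y = h ?e2"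
    obtain a b \<tau> where
      ab: "\<mu> (\<mu> x x) x = a *s \<mu> x x" "\<mu> (\<mu> x x) y = b *s \<mu> x x"
      "\<mu> (\<mu> (\<mu> y x) x) x - a *s \<mu> (\<mu> y x) x = \<tau> *s (\<mu> (\<mu> y x) x - a *s \<mu> y x)"
      "(\<phi> (\<mu> (\<mu> y x) x - (\<tau> / 2) *s (\<mu> y x - \<mu> x y) - a *s (\<mu> x y + \<mu> y x) + b *s \<mu> x x))\<^sup>2 =
        \<kappa> * \<tau>\<^sup>2 * (\<phi> (\<mu> x x) * \<phi> (\<mu> y y) - (\<phi> (\<mu> x y + \<mu> y x))\<^sup>2 / 4)"
      using id[OF \<phi>, of x y] by blast
    define q where "q = \<phi> (\<mu> x x)"
    define r where "r = \<phi> (\<mu> (\<mu> y x) x) - a * \<phi> (\<mu> y x)"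
    have h: "\<phi> (\<mu> (\<mu> x x) x) = a * q" "\<phi> (\<mu> (\<mu> x x) y) = b * q"
      by (simp_all add: ab(1,2) lin q_def)
    have r: "\<phi> (\<mu> (\<mu> (\<mu> y x) x) x) - a * \<phi> (\<mu> (\<mu> y x) x) = \<tau> * r"
      using arg_cong[OF ab(3), of \<phi>] unfolding r_def by (simp only: lin)
    have N: "(\<phi> (\<mu> (\<mu> y x) x) - \<tau> / 2 * (\<phi> (\<mu> y x) - \<phi> (\<mu> x y)) - a * (\<phi> (\<mu> x y) + \<phi> (\<mu> y x)) + b * q)\<^sup>2 =
        \<kappa> * \<tau>\<^sup>2 * (q * \<phi> (\<mu> y y) - (\<phi> (\<mu> x y) + \<phi> (\<mu> y x))\<^sup>2 / 4)"
      using ab(4) unfolding lin q_def .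
    have "F \<mu>' = P q (\<phi> (\<mu> y y)) (\<phi> (\<mu> x y)) (\<phi> (\<mu> y x)) (\<phi> (\<mu> (\<mu> y x) x))
        (\<phi> (\<mu> (\<mu> (\<mu> y x) x) x)) (a * q) (b * q)"
      unfolding h[symmetric] F_def g(1,3) by (simp add: q_def \<phi>_def x_def y_def)
    \<comment> \<open>Only substitution is used, no division, so vanishing \<open>q\<close> or
      \<open>r\<close> is covered.\<close>
    also have "\<dots> = (q * r * q)\<^sup>2 * ((\<phi> (\<mu> (\<mu> y x) x) - \<tau> / 2 * (\<phi> (\<mu> y x) - \<phi> (\<mu> x y)) -
          a * (\<phi> (\<mu> x y) + \<phi> (\<mu> y x)) + b * q)\<^sup>2 -
        \<kappa> * \<tau>\<^sup>2 * (q * \<phi> (\<mu> y y) - (\<phi> (\<mu> x y) + \<phi> (\<mu> y x))\<^sup>2 / 4))"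
    proof -
      have 1: "q * \<phi> (\<mu> (\<mu> y x) x) - a * q * \<phi> (\<mu> y x) = q * r"
        by (simp add: r_def algebra_simps)
      have 2: "q * \<phi> (\<mu> (\<mu> (\<mu> y x) x) x) - a * q * \<phi> (\<mu> (\<mu> y x) x) = q * (\<tau> * r)"
        by (simp add: r[symmetric] algebra_simps)
      have 3: "q * r * q * \<phi> (\<mu> (\<mu> y x) x) - 1 / 2 * q * (q * (\<tau> * r)) * (\<phi> (\<mu> y x) - \<phi> (\<mu> x y)) -
          a * q * (q * r) * (\<phi> (\<mu> x y) + \<phi> (\<mu> y x)) + b * q * (q * r) * q =
        q * r * q * (\<phi> (\<mu> (\<mu> y x) x) - \<tau> / 2 * (\<phi> (\<mu> y x) - \<phi> (\<mu> x y)) -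
          a * (\<phi> (\<mu> x y) + \<phi> (\<mu> y x)) + b * q)"
        by (simp add: field_simps)
      show ?thesis
        unfolding P_def 1 2 3 by (simp add: power_mult_distrib right_diff_distrib power2_eq_square mult_ac)
    qed
    also have "\<dots> = 0"
      unfolding N by simp
    finally show ?thesis .
  qed
  ultimately have "F heisenberg_ext = 0"
    using regular_fun_vanishes_at_degeneration[OF deg] by blast
  then show False
    by (simp add: F_def P_def axis_4_nth)
qed

text \<open>Rank can only drop in a closure, and the minor below is 1 at
  \<open>heisenberg_ext\<close>.\<close>

lemma right_annihilator_line:
  assumes \<mu>: "\<mu> \<in> alg_structures" and deg: "degenerates_to \<mu> heisenberg_ext"
    and i: "i \<noteq> 0" "\<And>x. \<mu> x i = 0" and j: "\<And>x. \<mu> x j = 0"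
  shows "\<exists>c. j = c *s i"
proof (rule ccontr)
  assume ind: "\<nexists>c. j = c *s i"
  let ?e1 = "axis 1 1 :: complex ^ 4" and ?e2 = "axis 2 1 :: complex ^ 4" and ?e3 = "axis 3 1 :: complex ^ 4"
  \<comment> \<open>a maximal minor of \<open>y \<mapsto> (e1 y, e2 y)\<close> restricted to \<open>\<langle>e1, e2, e3\<rangle>\<close>\<close>
  define P where "P a1 a2 a3 b1 b2 b3 c1 c2 c3 =
    a1 * (b2 * c3 - b3 * c2) - a2 * (b1 * c3 - b3 * c1) + a3 * (b1 * c2 - b2 * c1)"
    for a1 a2 a3 b1 b2 b3 c1 c2 c3 :: complex
  define F :: "4 alg \<Rightarrow> complex" where
    "F \<mu> = P (\<mu> ?e1 ?e1 $ 3) (\<mu> ?e1 ?e2 $ 3) (\<mu> ?e1 ?e3 $ 3)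
      (\<mu> ?e1 ?e1 $ 4) (\<mu> ?e1 ?e2 $ 4) (\<mu> ?e1 ?e3 $ 4)
      (\<mu> ?e2 ?e1 $ 3) (\<mu> ?e2 ?e2 $ 3) (\<mu> ?e2 ?e3 $ 3)" for \<mu>
  have "regular_fun F"
    unfolding F_def P_def by (intro regular_intros)
  moreover have "F \<mu>' = 0" if orb: "\<mu>' \<in> orbit \<mu>" for \<mu>'
  proof -
    obtain h g where "\<forall>v. h (g v) = v" "\<forall>v. g (h v) = v" "\<forall>x y. \<mu>' x y = g (\<mu> (h x) (h y))"
      "\<forall>x y. g (x + y) = g x + g y" "\<forall>c x. g (c *s x) = c *s g x" "g 0 = 0"
      using orbit_transport[OF orb] by blast
    note g = this[rule_format]
    \<comment> \<open>A plane of annihilated vectors meets the hyperplane where the fourth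
      coordinate of \<open>g\<close> vanishes.\<close>
    obtain y where y: "y \<noteq> 0" "g y $ 4 = 0" "\<And>x. \<mu> x y = 0"
    proof (cases "g i $ 4 = 0")
      case True
      then show ?thesis using that i by blast
    next
      case False
      define k where "k = g j $ 4 / g i $ 4"
      show ?thesis
      proof (rule that[of "j + (- k) *s i"])
        show "j + (- k) *s i \<noteq> 0"
          using ind by (metis add.inverse_inverse add_eq_0_iff vec.scale_minus_left)
        show "g (j + (- k) *s i) $ 4 = 0"
          unfolding g(4,5) k_def using False by simp
        show "\<mu> x (j + (- k) *s i) = 0" for x
          unfolding alg_structures_simps[OF \<mu>] i j by simp
      qed
    qed
    define y1 y2 y3 where "y1 = g y $ 1" and "y2 = g y $ 2" and "y3 = g y $ 3"
    have "g y = y1 *s ?e1 + y2 *s ?e2 + y3 *s ?e3"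
      using y(2) by (simp add: vec_eq_iff forall_4 axis_4_nth y1_def y2_def y3_def)
    also have "\<dots> = g (y1 *s h ?e1 + y2 *s h ?e2 + y3 *s h ?e3)"
      by (simp add: g(2,4,5))
    finally have yh: "y = y1 *s h ?e1 + y2 *s h ?e2 + y3 *s h ?e3"
      using g(1) by metis
    have "y1 *s \<mu>' x ?e1 + y2 *s \<mu>' x ?e2 + y3 *s \<mu>' x ?e3 = 0" for x
    proof -
      have "y1 *s \<mu>' x ?e1 + y2 *s \<mu>' x ?e2 + y3 *s \<mu>' x ?e3 = g (\<mu> (h x) y)"
        unfolding yh by (simp add: alg_structures_simps[OF \<mu>] g(3,4,5))
      then show ?thesis
        by (simp add: y(3) g(6))
    qed
    then have eq: "y1 * \<mu>' x ?e1 $ k + y2 * \<mu>' x ?e2 $ k + y3 * \<mu>' x ?e3 $ k = 0" for x k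
      by (metis vector_add_component vector_smult_component zero_index)
    have cramer: "P a1 a2 a3 b1 b2 b3 c1 c2 c3 = 0"
      if "y1 * a1 + y2 * a2 + y3 * a3 = 0" "y1 * b1 + y2 * b2 + y3 * b3 = 0" "y1 * c1 + y2 * c2 + y3 * c3 = 0"
      for a1 a2 a3 b1 b2 b3 c1 c2 c3
    proof -
      have "y1 * P a1 a2 a3 b1 b2 b3 c1 c2 c3 = 0" "y2 * P a1 a2 a3 b1 b2 b3 c1 c2 c3 = 0"
        "y3 * P a1 a2 a3 b1 b2 b3 c1 c2 c3 = 0"
        using that unfolding P_def by algebra+
      moreover have "y1 \<noteq> 0 \<or> y2 \<noteq> 0 \<or> y3 \<noteq> 0"
        using y(1) yh by auto
      ultimately show ?thesis
        by auto
    qed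
    show ?thesis
      unfolding F_def by (intro cramer eq)
  qed
  ultimately have "F heisenberg_ext = 0"
    using regular_fun_vanishes_at_degeneration[OF deg] by blast
  then show False
    by (simp add: F_def P_def axis_4_nth)
qed

text \<open>At \<open>heisenberg_ext\<close> the form is the identity on \<open>e1, e2\<close> in
  the fourth coordinate; having nonzero Gram determinant is an open condition.\<close>

lemma nondegenerate_squares:
  assumes deg: "degenerates_to \<mu> heisenberg_ext"
  shows "\<exists>x y \<phi>. linear_form \<phi> \<and> \<phi> (\<mu> x x) \<noteq> 0 \<and>
    \<phi> (\<mu> x x) * \<phi> (\<mu> y y) - (\<phi> (\<mu> x y + \<mu> y x))\<^sup>2 / 4 \<noteq> 0"
proof (rule ccontr)
  assume none: "\<not> ?thesis"
  let ?e1 = "axis 1 1 :: complex ^ 4" and ?e2 = "axis 2 1 :: complex ^ 4"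
  define F :: "4 alg \<Rightarrow> complex" where
    "F \<mu> = (\<mu> ?e1 ?e1 $ 4) * ((\<mu> ?e1 ?e1 $ 4) * (\<mu> ?e2 ?e2 $ 4) -
      (1 / 4) * ((\<mu> ?e1 ?e2 $ 4) + (\<mu> ?e2 ?e1 $ 4))\<^sup>2)" for \<mu>
  have "regular_fun F"
    unfolding F_def by (intro regular_intros)
  moreover have "F \<mu>' = 0" if orb: "\<mu>' \<in> orbit \<mu>" for \<mu>'
  proof -
    obtain h g where "\<forall>v. h (g v) = v" "\<forall>v. g (h v) = v" "\<forall>x y. \<mu>' x y = g (\<mu> (h x) (h y))"
      "\<forall>x y. g (x + y) = g x + g y" "\<forall>c x. g (c *s x) = c *s g x" "g 0 = 0"
      using orbit_transport[OF orb] by blast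
    note g = this[rule_format]
    have "linear_form (\<lambda>v. g v $ 4)"
      unfolding linear_form_def by (simp add: g(4,5))
    then have "g (\<mu> (h ?e1) (h ?e1)) $ 4 = 0 \<or> g (\<mu> (h ?e1) (h ?e1)) $ 4 * g (\<mu> (h ?e2) (h ?e2)) $ 4 -
        (g (\<mu> (h ?e1) (h ?e2) + \<mu> (h ?e2) (h ?e1)) $ 4)\<^sup>2 / 4 = 0"
      using none by blast
    then show ?thesis
      unfolding F_def g(3) by (auto simp: g(4))
  qed
  ultimately have "F heisenberg_ext = 0"
    using regular_fun_vanishes_at_degeneration[OF deg] by blast
  then show False
    by (simp add: F_def axis_4_nth)
qed

section \<open>Degenerations to the special algebra\<close>

lemma split_case:
  assumes \<mu>: "\<mu> \<in> leibniz_structures" and deg: "degenerates_to \<mu> heisenberg_ext"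
    and i: "i \<noteq> 0" "\<And>x. \<mu> x i = 0"
    and sq: "\<And>z. \<mu> z z = Q z *s i" and \<theta>: "\<And>z. \<mu> i z = \<theta> z *s i"
    and x: "\<theta> x \<noteq> 0"
  shows False
proof -
  note bil = alg_structures_simps[OF leibniz_alg[OF \<mu>]]
  define S where "S z w = Q (z + w) - Q z - Q w" for z w
  have S: "\<mu> z w + \<mu> w z = S z w *s i" for z w
  proof -
    have "\<mu> (z + w) (z + w) = \<mu> z z + (\<mu> z w + \<mu> w z) + \<mu> w w"
      by (simp add: bil algebra_simps)
    then show ?thesis
      unfolding sq S_def by (simp add: algebra_simps vec.scale_left_diff_distrib)
  qed
  define w where "w = (1 / \<theta> x) *s x"
  have w: "\<mu> i w = i"
    using x by (simp add: w_def bil \<theta>)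
  \<comment> \<open>As \<open>i w = i\<close> and \<open>w i = 0\<close>, this multiple of
    \<open>i\<close> cancels the square of \<open>w\<close>.\<close>
  define v2 where "v2 = w - Q w *s i"
  have v2: "\<mu> i v2 = i" "\<mu> v2 v2 = 0"
    unfolding v2_def bil i w sq[of w] by simp_all
  have "v2 \<notin> vec.span {i}"
    using v2(1) i by (auto simp: vec.span_singleton bil)
  moreover obtain c where "c \<notin> vec.span {v2, i}"
    using ex_notin_span3[of v2 v2 i] by auto
  moreover obtain d where "d \<notin> vec.span {c, v2, i}"
    using ex_notin_span3 by blast
  ultimately have fr: "is_frame i v2 c d"
    by (intro is_frameI i)
  \<comment> \<open>\<open>v\<close> projects onto the vectors killed by left multiplication by
    \<open>i\<close> that anticommute with \<open>v2\<close>.\<close>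
  define v where "v z = z + (- S z v2) *s i + (- \<theta> z) *s v2" for z
  have fr: "is_frame i v2 (v c) (v d)"
    using is_frame_shear[OF fr, of "- S c v2" "- \<theta> c" "- S d v2" "- \<theta> d" 0] unfolding v_def by simp
  have iv: "\<mu> i (v z) = 0" for z
    unfolding v_def bil i v2 \<theta>[of z] by (simp add: vec_eq_iff)
  have vv2: "\<mu> v2 (v z) = - \<mu> (v z) v2" for z
  proof -
    have "\<mu> v2 (v z) + \<mu> (v z) v2 = (\<mu> z v2 + \<mu> v2 z) - S z v2 *s i"
      unfolding v_def bil i v2 by (simp add: algebra_simps)
    then show ?thesis
      unfolding S[of z v2] by (simp add: eq_neg_iff_add_eq_0)
  qed
  \<comment> \<open>Right multiplications act on the line of \<open>i\<close> by scalars and so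
    commute there. Hence products have no \<open>v2\<close>-coordinate.\<close>
  have ip: "\<mu> i (\<mu> y z) = 0" for y z
    using leibniz_identity[OF \<mu>, of i y z] by (simp add: \<theta> bil mult.commute)
  interpret F: framed_leibniz \<mu> i v2 "v c" "v d"
    by (rule framed_leibnizI[OF \<mu> fr])
  have pr: "\<exists>a b e. \<mu> y z = F.V a 0 b e" for y z
  proof -
    obtain a k b e where p: "\<mu> y z = F.V a k b e"
      by (rule F.V_cases)
    have "\<mu> i (F.V a k b e) = 0"
      using ip[of y z] p by simp
    then have "k *s i = 0"
      unfolding F.V_def bil i v2 iv by simp
    then show ?thesis
      using p i(1) by auto
  qed
  have iV: "k *s i = F.V k 0 0 0" for k
    by (simp add: F.V_def)
  obtain h1 d11 d21 where 1: "\<mu> (v c) v2 = F.V h1 0 d11 d21" using pr by blast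
  obtain h2 d12 d22 where 2: "\<mu> (v d) v2 = F.V h2 0 d12 d22" using pr by blast
  obtain f12 b1 b2 where 3: "\<mu> (v c) (v d) = F.V f12 0 b1 b2" using pr by blast
  have 4: "\<mu> (v d) (v c) = F.V (S (v c) (v d) - f12) 0 (- b1) (- b2)"
  proof -
    have "\<mu> (v d) (v c) = F.V (S (v c) (v d)) 0 0 0 - F.V f12 0 b1 b2"
      unfolding eq_diff_eq using S[of "v c" "v d"] unfolding 3 iV by (simp only: add.commute)
    then show ?thesis
      unfolding F.V_diff by simp
  qed
  interpret split_leibniz \<mu> i v2 "v c" "v d" h1 h2 d11 d12 d21 d22 "Q (v c)" "Q (v d)" f12
    "S (v c) (v d) - f12" b1 b2
    by unfold_locales (simp_all add: i iv v2 vv2 1 2 3 4 sq[of "v c"] sq[of "v d"] iV[symmetric])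
  show False
  proof (cases "b1 = 0 \<and> b2 = 0")
    case True
    then show False
      by (intro no_degeneration_if_linear_identity[OF deg linear_identity]) simp_all
  next
    case False
    then have b: "b1 \<noteq> 0 \<or> b2 \<noteq> 0"
      by blast
    show False
      by (rule no_degeneration_if_quadratic_identity[OF deg]) (rule quadratic_identity[OF b])
  qed
qed

lemma central_case:
  assumes \<mu>: "\<mu> \<in> leibniz_structures" and deg: "degenerates_to \<mu> heisenberg_ext"
    and i: "i \<noteq> 0" "\<And>x. \<mu> x i = 0" "\<And>x. \<mu> i x = 0"
    and sq: "\<And>z. \<mu> z z = Q z *s i"
    and e: "\<mu> e1 e1 = i" "\<mu> e2 e2 = \<gamma> *s i" "\<gamma> \<noteq> 0" "\<mu> e2 e1 = - \<mu> e1 e2"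
  shows "nilpotent_alg \<mu>"
proof (rule ccontr)
  assume nn: "\<not> nilpotent_alg \<mu>"
  note bil = alg_structures_simps[OF leibniz_alg[OF \<mu>]]
  define S where "S z w = Q (z + w) - Q z - Q w" for z w
  have S: "\<mu> z w + \<mu> w z = S z w *s i" for z w
  proof -
    have "\<mu> (z + w) (z + w) = \<mu> z z + (\<mu> z w + \<mu> w z) + \<mu> w w"
      by (simp add: bil algebra_simps)
    then show ?thesis
      unfolding sq S_def by (simp add: algebra_simps vec.scale_left_diff_distrib)
  qed
  have "e1 \<notin> vec.span {i}"
  proof
    assume "e1 \<in> vec.span {i}"
    then obtain k where "e1 = k *s i"
      by (auto simp: vec.span_singleton)
    then have "\<mu> e1 e1 = \<mu> e1 (k *s i)"
      by (rule arg_cong)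
    then show False
      using i(1) unfolding bil i(2) e(1) by simp
  qed
  moreover have "e2 \<notin> vec.span {e1, i}"
  proof
    assume "e2 \<in> vec.span {e1, i}"
    then obtain k l where e2: "e2 = k *s e1 + l *s i"
      unfolding vec.span_breakdown_eq vec.span_empty by (auto simp: algebra_simps)
    have "k *s i = - (k *s i)"
      using e(4) unfolding e2 bil i e(1) by simp
    then have "k = 0"
      using i(1) by (simp add: eq_neg_iff_add_eq_0 vec.scale_left_distrib[symmetric])
    then show False
      using e(2,3) i unfolding e2 by (simp add: bil)
  qed
  moreover obtain d where "d \<notin> vec.span {e2, e1, i}"
    using ex_notin_span3 by blast
  ultimately have fr: "is_frame i e1 e2 d"
    by (intro is_frameI i)
  \<comment> \<open>Gram-Schmidt for \<open>S\<close>, with \<open>S e1 e1 = 2\<close> and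
    \<open>S e2 e2 = 2 * \<gamma>\<close>.\<close>
  define e3 where "e3 = d + 0 *s i + (- (S d e1 / 2)) *s e1 + (- (S d e2 / (2 * \<gamma>))) *s e2"
  have fr: "is_frame i e1 e2 e3"
    using is_frame_shear[OF fr, of 0 0 0 "- (S d e1 / 2)" "- (S d e2 / (2 * \<gamma>))"] unfolding e3_def by simp
  have e3: "\<mu> e1 e3 = - \<mu> e3 e1" "\<mu> e2 e3 = - \<mu> e3 e2"
  proof -
    have "\<mu> e1 e3 + \<mu> e3 e1 = (\<mu> d e1 + \<mu> e1 d) - S d e1 *s i"
      unfolding e3_def bil i e by (simp add: vec_eq_iff algebra_simps)
    then show "\<mu> e1 e3 = - \<mu> e3 e1"
      unfolding S[of d e1] by (simp add: eq_neg_iff_add_eq_0)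
    have "\<mu> e2 e3 + \<mu> e3 e2 = (\<mu> d e2 + \<mu> e2 d) - S d e2 *s i"
      unfolding e3_def bil i e using e(3) by (simp add: vec_eq_iff algebra_simps)
    then show "\<mu> e2 e3 = - \<mu> e3 e2"
      unfolding S[of d e2] by (simp add: eq_neg_iff_add_eq_0)
  qed
  interpret F: framed_leibniz \<mu> i e1 e2 e3
    by (rule framed_leibnizI[OF \<mu> fr])
  have iV: "k *s i = F.V k 0 0 0" for k
    by (simp add: F.V_def)
  obtain n m1 m2 m3 where 1: "\<mu> e1 e2 = F.V n m1 m2 m3" by (rule F.V_cases)
  obtain s p1 p2 p3 where 2: "\<mu> e3 e1 = F.V s p1 p2 p3" by (rule F.V_cases)
  obtain t q1 q2 q3 where 3: "\<mu> e3 e2 = F.V t q1 q2 q3" by (rule F.V_cases)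
  interpret central_leibniz \<mu> i e1 e2 e3 n m1 m2 m3 s p1 p2 p3 t q1 q2 q3 \<gamma> "Q e3"
    by unfold_locales (simp_all add: i e(1,2,3) e(4) e3 1 2 3 sq[of e3] iV[symmetric])
  have "Q e3 = 0 \<and> p2 = 0 \<and> q1 = 0 \<and> (p3 \<noteq> 0 \<or> q3 \<noteq> 0) \<and> (\<exists>\<sigma>. s = \<sigma> * p3 \<and> t = \<sigma> * q3)"
    by (rule disjE[OF nilpotent_or], erule notE[OF nn], assumption)
  then obtain \<sigma> where \<sigma>: "Q e3 = 0" "p2 = 0" "q1 = 0" "s = \<sigma> * p3" "t = \<sigma> * q3"
    by blast
  show False
    by (rule no_degeneration_if_quadratic_identity[OF deg]) (rule quadratic_identity[OF \<sigma>])
qed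

text \<open>The one-dimensional right annihilator contains all squares and all
  \<open>\<mu> i z\<close>, which yields \<open>Q\<close> and the character \<theta>. A nonzero
  \<theta> is excluded by \<open>split_case\<close>; otherwise \<open>i\<close> is central.\<close>

lemma degenerates_to_heisenberg_ext_nilpotent:
  assumes \<mu>: "\<mu> \<in> leibniz_structures" and deg: "degenerates_to \<mu> heisenberg_ext"
  shows "nilpotent_alg \<mu>"
proof -
  note alg = leibniz_alg[OF \<mu>]
  note bil = alg_structures_simps[OF alg]
  obtain x y \<phi> where \<phi>: "linear_form \<phi>" and nz: "\<phi> (\<mu> x x) \<noteq> 0"
    "\<phi> (\<mu> x x) * \<phi> (\<mu> y y) - (\<phi> (\<mu> x y + \<mu> y x))\<^sup>2 / 4 \<noteq> 0"
    using nondegenerate_squares[OF deg] by blast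
  define i where "i = \<mu> x x"
  have lin: "\<phi> (c *s v) = c * \<phi> v" for c v
    using \<phi> unfolding linear_form_def by blast
  have i0: "i \<noteq> 0"
    using nz(1) lin[of 0 0] unfolding i_def by auto
  \<comment> \<open>In \<open>(wz)z = (wz)z + w(zz)\<close> the first two terms cancel.\<close>
  have sq0: "\<mu> w (\<mu> z z) = 0" for w z
    using leibniz_identity[OF \<mu>, of w z z] by simp
  have xi: "\<mu> w i = 0" for w
    unfolding i_def by (rule sq0)
  have line: "\<exists>c. j = c *s i" if "\<And>w. \<mu> w j = 0" for j
    by (rule right_annihilator_line[OF alg deg i0 xi that])
  have "\<forall>z. \<exists>c. \<mu> z z = c *s i"
    using line sq0 by blast
  then obtain Q where Q: "\<And>z. \<mu> z z = Q z *s i"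
    by metis
  have "\<mu> w (\<mu> i z) = 0" for w z
    using leibniz_identity[OF \<mu>, of w i z] by (simp add: xi bil)
  then have "\<forall>z. \<exists>c. \<mu> i z = c *s i"
    using line by blast
  then obtain \<theta> where \<theta>: "\<And>z. \<mu> i z = \<theta> z *s i"
    by metis
  show ?thesis
  proof (cases "\<exists>z. \<theta> z \<noteq> 0")
    case True
    then show ?thesis
      using split_case[OF \<mu> deg i0 xi Q \<theta>] by blast
  next
    case False
    then have ix: "\<mu> i z = 0" for z
      using \<theta>[of z] by simp
    define S where "S = Q (x + y) - Q x - Q y"
    have S: "\<mu> x y + \<mu> y x = S *s i"
    proof -
      have "\<mu> (x + y) (x + y) = \<mu> x x + (\<mu> x y + \<mu> y x) + \<mu> y y"
        by (simp add: bil algebra_simps)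
      then show ?thesis
        unfolding Q S_def by (simp add: algebra_simps vec.scale_left_diff_distrib)
    qed
    \<comment> \<open>Completing the square: \<open>e2\<close> is orthogonal to \<open>x\<close>,
      and the coefficient of its square is the Gram determinant of \<open>x, y\<close>, because
      \<open>Q x = 1\<close>.\<close>
    define e2 where "e2 = y - (S / 2) *s x"
    have "\<mu> e2 e2 = \<mu> y y - (S / 2) *s (\<mu> x y + \<mu> y x) + (S / 2)\<^sup>2 *s \<mu> x x"
      by (simp add: e2_def bil vec_eq_iff algebra_simps power2_eq_square)
    then have 2: "\<mu> e2 e2 = (Q y - S\<^sup>2 / 4) *s i"
      unfolding S Q[of y] i_def[symmetric]
      by (simp add: vec_eq_iff algebra_simps power2_eq_square)
    have "\<phi> i * (Q y * \<phi> i) - (S * \<phi> i)\<^sup>2 / 4 = (Q y - S\<^sup>2 / 4) * (\<phi> i)\<^sup>2"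
      by (simp add: field_simps power2_eq_square)
    then have 3: "Q y - S\<^sup>2 / 4 \<noteq> 0"
      using nz(2) unfolding S Q[of y] i_def[symmetric] lin by auto
    have "\<mu> e2 x + \<mu> x e2 = (\<mu> x y + \<mu> y x) - S *s \<mu> x x"
      by (simp add: e2_def bil vec_eq_iff algebra_simps)
    then have 4: "\<mu> e2 x = - \<mu> x e2"
      unfolding S i_def[symmetric] by (simp add: eq_neg_iff_add_eq_0)
    show ?thesis
      by (rule central_case[OF \<mu> deg i0 xi ix Q i_def[symmetric] 2 3 4])
  qed
qed

theorem theorem4:
  "\<not> grunewald_ohalloran_property (leibniz_structures :: 4 alg set)"
  unfolding grunewald_ohalloran_property_def
  using heisenberg_ext_leibniz heisenberg_ext_nilpotent degenerates_to_heisenberg_ext_nilpotent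
  by blast

end
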